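(* There are an effectively $\lambda$-measurable set $\mathcal A\subseteq 2^\omega$ and a universal Martin-Löf test $\mathcal W$ such that $\mathcal A$ is not $\mathcal W$-layerwise decidable.
   Context: Work in Cantor space $2^\omega$ with Lebesgue measure $\lambda$. For $\sigma\in 2^{<\omega}$, $[\sigma]=\{X\in 2^\omega:\sigma\prec X\}$. A sequence $(\mathcal U_i)_{i\in\omega}$ of open subsets of $2^\omega$ is uniformly effectively open if $\{\langle i,\sigma\rangle : [\sigma]\subseteq\mathcal U_i\}$ is computably enumerable. A Martin-Löf (ML) test is a uniformly effectively open sequence $(\mathcal V_i)_{i\in\omega}$ with $\lambda(\mathcal V_i)\le 2^{-i}$ for all $i$; it is universal if $\bigcap_i\mathcal V'_i\subseteq\bigcap_i\mathcal V_i$ for every ML-test $\mathcal V'$. A set $\mathcal A\subseteq 2^\omega$ is effectively $\lambda$-measurable if there are uniformly effectively open sequences $(\mathcal U_i)_{i}$ and $(\mathcal V_i)_i$ with $2^\omega\setminus\mathcal V_i\subseteq\mathcal A\subseteq\mathcal U_i$ and $\lambda(\mathcal U_i\cap\mathcal V_i)\le 2^{-i}$ for all $i$. For a universal ML-test $\mathcal W$, a set $\mathcal A$ is $\mathcal W$-layerwise semi-decidable if there is a uniformly effectively open sequence $(\mathcal U_i)_i$ with $\mathcal A\cap(2^\omega\setminus\mathcal W_i)=\mathcal U_i\cap(2^\omega\setminus\mathcal W_i)$ for all $i$, and $\mathcal W$-layerwise decidable if both $\mathcal A$ and $2^\omega\setminus\mathcal A$ are $\mathcal W$-layerwise semi-decidable.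 *)

theory Defs
  imports "HOL-Probability.Probability" "HOL-Library.Nat_Bijection"
begin

text \<open>Primitive recursive functions on argument lists (style of Paulson's Primrec
  example): missing arguments default to 0.\<close>

fun hd0 :: "nat list \<Rightarrow> nat" where
  "hd0 [] = 0"
| "hd0 (x # xs) = x"

definition nth0 :: "nat list \<Rightarrow> nat \<Rightarrow> nat" where
  "nth0 xs i = (if i < length xs then xs ! i else 0)"

fun PREC :: "(nat list \<Rightarrow> nat) \<Rightarrow> (nat list \<Rightarrow> nat) \<Rightarrow> nat list \<Rightarrow> nat" where
  "PREC f g [] = f []"
| "PREC f g (x # xs) = rec_nat (f xs) (\<lambda>y r. g (r # y # xs)) x"

inductive PRIMREC :: "(nat list \<Rightarrow> nat) \<Rightarrow> bool" where
  zero: "PRIMREC (\<lambda>_. 0)"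
| suc: "PRIMREC (\<lambda>xs. Suc (hd0 xs))"
| proj: "PRIMREC (\<lambda>xs. nth0 xs i)"
| comp: "PRIMREC g \<Longrightarrow> (\<forall>f\<in>set fs. PRIMREC f) \<Longrightarrow> PRIMREC (\<lambda>xs. g (map (\<lambda>f. f xs) fs))"
| prec: "PRIMREC f \<Longrightarrow> PRIMREC g \<Longrightarrow> PRIMREC (PREC f g)"

text \<open>A set of naturals is computably enumerable iff it is the projection of a
  primitive recursive relation (Kleene normal form).\<close>
definition ce :: "nat set \<Rightarrow> bool" where
  "ce S \<longleftrightarrow> (\<exists>f. PRIMREC f \<and> S = {x. \<exists>y. f [x, y] = 0})"

text \<open>Bijective coding of binary strings by naturals.\<close>
fun str_code :: "bool list \<Rightarrow> nat" where
  "str_code [] = 0"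
| "str_code (b # s) = 2 * str_code s + (if b then 2 else 1)"

definition cyl :: "bool list \<Rightarrow> (nat \<Rightarrow> bool) set" where
  "cyl \<sigma> = {X. \<forall>i<length \<sigma>. X i = \<sigma> ! i}"

definition lam :: "(nat \<Rightarrow> bool) measure" where
  "lam = PiM UNIV (\<lambda>_. measure_pmf (bernoulli_pmf (1/2)))"

definition unif_eff_open :: "(nat \<Rightarrow> (nat \<Rightarrow> bool) set) \<Rightarrow> bool" where
  "unif_eff_open U \<longleftrightarrow>
     (\<forall>i. U i = \<Union>{cyl \<sigma> | \<sigma>. cyl \<sigma> \<subseteq> U i}) \<and>
     ce {prod_encode (i, str_code \<sigma>) | i \<sigma>. cyl \<sigma> \<subseteq> U i}"

definition mltest :: "(nat \<Rightarrow> (nat \<Rightarrow> bool) set) \<Rightarrow> bool" where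
  "mltest V \<longleftrightarrow> unif_eff_open V \<and> (\<forall>i. emeasure lam (V i) \<le> ennreal ((1/2) ^ i))"

definition universal_mltest :: "(nat \<Rightarrow> (nat \<Rightarrow> bool) set) \<Rightarrow> bool" where
  "universal_mltest W \<longleftrightarrow> mltest W \<and>
     (\<forall>V. mltest V \<longrightarrow> (\<Inter>i. V i) \<subseteq> (\<Inter>i. W i))"

definition eff_measurable :: "(nat \<Rightarrow> bool) set \<Rightarrow> bool" where
  "eff_measurable A \<longleftrightarrow> (\<exists>U V. unif_eff_open U \<and> unif_eff_open V \<and>
     (\<forall>i. - V i \<subseteq> A \<and> A \<subseteq> U i \<and> emeasure lam (U i \<inter> V i) \<le> ennreal ((1/2) ^ i)))"

definition layerwise_semidec :: "(nat \<Rightarrow> (nat \<Rightarrow> bool) set) \<Rightarrow> (nat \<Rightarrow> bool) set \<Rightarrow> bool" where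
  "layerwise_semidec W A \<longleftrightarrow> (\<exists>U. unif_eff_open U \<and> (\<forall>i. A \<inter> - W i = U i \<inter> - W i))"

definition layerwise_dec :: "(nat \<Rightarrow> (nat \<Rightarrow> bool) set) \<Rightarrow> (nat \<Rightarrow> bool) set \<Rightarrow> bool" where
  "layerwise_dec W A \<longleftrightarrow> layerwise_semidec W A \<and> layerwise_semidec W (- A)"

end

theory Submission
  imports Defs "HOL-Library.Sublist"
begin

text \<open>Let G generate a universal test, put the cell of i to be the cylinder of the string 0...01 with i
  zeros, and let the i-th of all uniformly effectively open sequences compete for the complement of A
  at layer i. The layer W i enumerates the (i+2)-nd component of the universal test until, at some
  stage, the competitor together with W i covers the cell. If this never happens, the competitor
  misses a point of the cell outside W i, and A stays empty in the cell. If it happens, some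
  cylinder inside the cell is still disjoint from W i; it is put into A, and from then on W i enumerates
  only a component of the universal test that is too small to cover this cylinder. Hence W i misses a point of A
  that the competitor contains. The new cylinder can be made as small as we like, as a function of
  the stage, which keeps A effectively measurable.\<close>

subsection \<open>Primitive recursive functions of one argument\<close>

text \<open>\<open>A\<close> is effectively open, so only its complement can be made to fail. The
  constants follow from a measure budget: the cell has measure 2^-(i+1), so component
  \<open>i + 2\<close> can never cover it, and its 2^-(i+2) leaves room in the bound 2^-i for the
  component that is added after coverage. Some complete component has to be added then, since
  universality is obtained by letting every layer contain one. Coverage has to be recognised at a
  finite stage, and effective openness refers to all cylinders contained in a set; both are handled
  by compactness. Computable enumerability is defined through primitive recursion, so listing all
  competitors requires a universal c.e. predicate. No primitive recursive function evaluates all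
  primitive recursive functions; evaluations are therefore found by searching for finite tables of
  claims that justify each other.\<close>

lemma hd0_eq: "hd0 xs = nth0 xs 0"
  by (cases xs) (auto simp: nth0_def)

lemma nth0_simps [simp]:
  "nth0 (x # xs) 0 = x" "nth0 (x # xs) (Suc n) = nth0 xs n" "nth0 [] n = 0"
  by (auto simp: nth0_def)

lemma nth0_numeral [simp]: "nth0 (x # xs) (numeral k) = nth0 xs (pred_numeral k)"
  by (simp add: numeral_eq_Suc)

lemma PRIMREC_comp1:
  assumes "PRIMREC (\<lambda>xs. g (nth0 xs 0))" "PRIMREC f"
  shows "PRIMREC (\<lambda>xs. g (f xs))"
  using PRIMREC.comp[OF assms(1), of "[f]"] assms(2) by simp

lemma PRIMREC_Suc: "PRIMREC f \<Longrightarrow> PRIMREC (\<lambda>xs. Suc (f xs))"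
  using PRIMREC_comp1[of Suc f] PRIMREC.suc by (simp add: hd0_eq)

lemma PRIMREC_const: "PRIMREC (\<lambda>_. c)"
  by (induction c) (auto intro: PRIMREC.zero PRIMREC_Suc)

text \<open>\<open>PREC\<close> hands its step function the recursive value, the counter and then
  the parameters, which fixes the indices 0, 1, 2. One parameter is enough once arguments are packed
  by pairing.\<close>

lemma PRIMREC_rec:
  assumes "PRIMREC (\<lambda>xs. a (nth0 xs 0))"
    and "PRIMREC (\<lambda>xs. G (nth0 xs 2) (nth0 xs 1) (nth0 xs 0))"
    and "PRIMREC n" "PRIMREC b"
  shows "PRIMREC (\<lambda>xs. rec_nat (a (b xs)) (\<lambda>y r. G (b xs) y r) (n xs))"
  using PRIMREC.comp[OF PRIMREC.prec[OF assms(1,2)], of "[n, b]"] assms(3,4) by simp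

lemma PRIMREC_add: "PRIMREC f \<Longrightarrow> PRIMREC g \<Longrightarrow> PRIMREC (\<lambda>xs. f xs + g xs)"
proof -
  have eq: "m + n = rec_nat n (\<lambda>_ r. Suc r) m" for m n :: nat
    by (induction m) auto
  show "PRIMREC f \<Longrightarrow> PRIMREC g \<Longrightarrow> PRIMREC (\<lambda>xs. f xs + g xs)"
    unfolding eq by (intro PRIMREC_rec[where a = "\<lambda>x. x"] PRIMREC_Suc PRIMREC.proj)
qed

lemma PRIMREC_mult: "PRIMREC f \<Longrightarrow> PRIMREC g \<Longrightarrow> PRIMREC (\<lambda>xs. f xs * g xs)"
proof -
  have eq: "m * n = rec_nat 0 (\<lambda>_ r. n + r) m" for m n :: nat
    by (induction m) auto
  show "PRIMREC f \<Longrightarrow> PRIMREC g \<Longrightarrow> PRIMREC (\<lambda>xs. f xs * g xs)"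
    unfolding eq
    by (intro PRIMREC_rec[where a = "\<lambda>x. 0" and G = "\<lambda>b y r. b + r"] PRIMREC_add PRIMREC.proj PRIMREC_const)
qed

lemma PRIMREC_pred: "PRIMREC f \<Longrightarrow> PRIMREC (\<lambda>xs. rec_nat 0 (\<lambda>y _. y) (f xs))"
  by (intro PRIMREC_rec[where a = "\<lambda>x. 0" and G = "\<lambda>b y r. y" and b = "\<lambda>_. 0"] PRIMREC.proj PRIMREC_const)

lemma PRIMREC_diff: "PRIMREC f \<Longrightarrow> PRIMREC g \<Longrightarrow> PRIMREC (\<lambda>xs. f xs - g xs)"
proof -
  have "rec_nat 0 (\<lambda>y _. y) n = n - 1" for n :: nat
    by (cases n) auto
  then have eq: "m - n = rec_nat m (\<lambda>_ r. rec_nat 0 (\<lambda>y _. y) r) n" for m n :: nat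
    by (induction n) auto
  show "PRIMREC f \<Longrightarrow> PRIMREC g \<Longrightarrow> PRIMREC (\<lambda>xs. f xs - g xs)"
    unfolding eq by (intro PRIMREC_rec[where a = "\<lambda>x. x" and G = "\<lambda>b y r. rec_nat 0 (\<lambda>y _. y) r"]
      PRIMREC_pred PRIMREC.proj)
qed

section \<open>Cantor pairing and its projections\<close>

lemma PRIMREC_triangle: "PRIMREC f \<Longrightarrow> PRIMREC (\<lambda>xs. triangle (f xs))"
proof -
  have eq: "triangle n = rec_nat 0 (\<lambda>y r. r + Suc y) n" for n :: nat
    by (induction n) auto
  show "PRIMREC f \<Longrightarrow> PRIMREC (\<lambda>xs. triangle (f xs))"
    unfolding eq
    by (intro PRIMREC_rec[where a = "\<lambda>x. 0" and G = "\<lambda>b y r. r + Suc y" and b = "\<lambda>_. 0"]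
        PRIMREC_add PRIMREC_Suc PRIMREC.proj PRIMREC_const)
qed

abbreviation pair :: "nat \<Rightarrow> nat \<Rightarrow> nat" where
  "pair a b \<equiv> prod_encode (a, b)"

definition pfst :: "nat \<Rightarrow> nat" where "pfst z = fst (prod_decode z)"

definition psnd :: "nat \<Rightarrow> nat" where "psnd z = snd (prod_decode z)"

lemma pfst_pair [simp]: "pfst (pair a b) = a"
  and psnd_pair [simp]: "psnd (pair a b) = b"
  and pair_collapse [simp]: "pair (pfst z) (psnd z) = z"
  by (auto simp: pfst_def psnd_def)

lemma PRIMREC_pair: "PRIMREC f \<Longrightarrow> PRIMREC g \<Longrightarrow> PRIMREC (\<lambda>xs. pair (f xs) (g xs))"
  unfolding prod_encode_def by (simp add: PRIMREC_add PRIMREC_triangle)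

text \<open>The number of the diagonal of the Cantor pairing on which \<open>z\<close> lies, i.e.
  the largest \<open>w\<close> with \<open>triangle w \<le> z\<close>. Truncated subtraction acts as
  a test: the summand is 1 exactly when \<open>triangle (Suc r) \<le> Suc y\<close>.\<close>

definition tri_root :: "nat \<Rightarrow> nat" where
  "tri_root z = rec_nat 0 (\<lambda>y r. r + (1 - (triangle (Suc r) - Suc y))) z"

lemma tri_root: "triangle (tri_root z) \<le> z \<and> z < triangle (Suc (tri_root z))"
proof (induction z)
  case (Suc z)
  have step: "tri_root (Suc z) = tri_root z + (1 - (triangle (Suc (tri_root z)) - Suc z))"
    by (simp add: tri_root_def)
  show ?case
  proof (cases "triangle (Suc (tri_root z)) = Suc z")
    case True
    with step have "tri_root (Suc z) = Suc (tri_root z)" by simp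
    with True show ?thesis by simp
  next
    case False
    with Suc step have "tri_root (Suc z) = tri_root z" by simp
    with False Suc show ?thesis by simp
  qed
qed (simp add: tri_root_def)

lemma triangle_mono: "m \<le> n \<Longrightarrow> triangle m \<le> triangle n"
  by (induction rule: dec_induct) simp_all

lemma tri_root_unique:
  assumes "triangle w \<le> z" "z < triangle (Suc w)"
  shows "tri_root z = w"
proof (rule antisym)
  show "tri_root z \<le> w"
    using assms(2) tri_root[of z] triangle_mono[of "Suc w" "tri_root z"]
    by (meson not_less_eq_eq order_le_less_trans leD)
  show "w \<le> tri_root z"
    using assms(1) tri_root[of z] triangle_mono[of "Suc (tri_root z)" w]
    by (meson not_less_eq_eq order_le_less_trans leD)
qed

lemma tri_root_pair: "tri_root (pair a b) = a + b"
  by (rule tri_root_unique) (auto simp: prod_encode_def)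

lemma pfst_eq: "pfst z = z - triangle (tri_root z)"
proof -
  have "pfst (pair a b) = pair a b - triangle (tri_root (pair a b))" for a b
    by (simp add: tri_root_pair) (simp add: prod_encode_def)
  from this[of "pfst z" "psnd z"] show ?thesis by simp
qed

lemma psnd_eq: "psnd z = tri_root z - pfst z"
  using tri_root_pair[of "pfst z" "psnd z"] by simp

lemma PRIMREC_tri_root: "PRIMREC f \<Longrightarrow> PRIMREC (\<lambda>xs. tri_root (f xs))"
  unfolding tri_root_def
  by (intro PRIMREC_rec[where a = "\<lambda>x. 0" and b = "\<lambda>_. 0"
        and G = "\<lambda>b y r. r + (1 - (triangle (Suc r) - Suc y))"]
      PRIMREC_add PRIMREC_diff PRIMREC_triangle PRIMREC_Suc PRIMREC.proj PRIMREC_const)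

lemma PRIMREC_pfst: "PRIMREC f \<Longrightarrow> PRIMREC (\<lambda>xs. pfst (f xs))"
  unfolding pfst_eq by (intro PRIMREC_diff PRIMREC_triangle PRIMREC_tri_root)

lemma PRIMREC_psnd: "PRIMREC f \<Longrightarrow> PRIMREC (\<lambda>xs. psnd (f xs))"
  unfolding psnd_eq by (intro PRIMREC_diff PRIMREC_pfst PRIMREC_tri_root)

text \<open>Unary functions suffice because arguments can be packed by \<open>pair\<close>;
  substitution then becomes composition, and closure properties can serve as introduction
  rules.\<close>

definition pr :: "(nat \<Rightarrow> nat) \<Rightarrow> bool" where
  "pr f \<longleftrightarrow> PRIMREC (\<lambda>xs. f (nth0 xs 0))"

lemma pr_id: "pr (\<lambda>x. x)"
  unfolding pr_def by (rule PRIMREC.proj)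

lemma pr_const: "pr (\<lambda>x. c)"
  unfolding pr_def by (rule PRIMREC_const)

lemma pr_compose: "pr g \<Longrightarrow> pr f \<Longrightarrow> pr (\<lambda>x. g (f x))"
  unfolding pr_def by (rule PRIMREC_comp1)

lemma pr_compose2:
  assumes "pr (\<lambda>z. g (pfst z) (psnd z))" "pr f1" "pr f2"
  shows "pr (\<lambda>x. g (f1 x) (f2 x))"
proof -
  have "PRIMREC (\<lambda>xs. pair (f1 (nth0 xs 0)) (f2 (nth0 xs 0)))"
    using assms(2,3) unfolding pr_def by (rule PRIMREC_pair)
  from PRIMREC_comp1[OF assms(1)[unfolded pr_def] this] show ?thesis
    by (simp add: pr_def)
qed

lemma
  assumes "pr f"
  shows pr_Suc: "pr (\<lambda>x. Suc (f x))"
    and pr_pfst: "pr (\<lambda>x. pfst (f x))"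
    and pr_psnd: "pr (\<lambda>x. psnd (f x))"
  using assms unfolding pr_def
  by (rule PRIMREC_Suc, rule PRIMREC_pfst, rule PRIMREC_psnd)

lemma
  assumes "pr f" "pr g"
  shows pr_add: "pr (\<lambda>x. f x + g x)"
    and pr_diff: "pr (\<lambda>x. f x - g x)"
    and pr_mult: "pr (\<lambda>x. f x * g x)"
    and pr_pair: "pr (\<lambda>x. pair (f x) (g x))"
  using assms unfolding pr_def
  by (rule PRIMREC_add, rule PRIMREC_diff, rule PRIMREC_mult, rule PRIMREC_pair)

lemma pr_rec:
  assumes "pr n" "pr a" "pr (\<lambda>z. G (pfst z) (pfst (psnd z)) (psnd (psnd z)))"
  shows "pr (\<lambda>x. rec_nat (a x) (\<lambda>y r. G x y r) (n x))"
proof -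
  have "PRIMREC (\<lambda>xs. pair (nth0 xs 2) (pair (nth0 xs 1) (nth0 xs 0)))"
    by (intro PRIMREC_pair PRIMREC.proj)
  from PRIMREC_comp1[OF assms(3)[unfolded pr_def] this]
  have "PRIMREC (\<lambda>xs. G (nth0 xs 2) (nth0 xs 1) (nth0 xs 0))" by simp
  from PRIMREC_rec[OF assms(2)[unfolded pr_def] this assms(1)[unfolded pr_def] PRIMREC.proj[of 0]]
  show ?thesis unfolding pr_def .
qed

lemma pr_power: "pr f \<Longrightarrow> pr g \<Longrightarrow> pr (\<lambda>x. f x ^ g x)"
proof -
  have eq: "m ^ n = rec_nat 1 (\<lambda>_ r. m * r) n" for m n :: nat
    by (induction n) auto
  assume f: "pr f" and g: "pr g"
  show "pr (\<lambda>x. f x ^ g x)"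
    unfolding eq by (intro pr_rec pr_mult pr_const pr_compose[OF f] g pr_psnd pr_pfst pr_id)
qed

lemma pr_sum:
  assumes "pr n" "pr (\<lambda>z. F (pfst z) (psnd z))"
  shows "pr (\<lambda>x. \<Sum>y<n x. F x y)"
proof -
  have eq: "(\<Sum>y<m. F x y) = rec_nat 0 (\<lambda>y r. r + F x y) m" for m x
    by (induction m) auto
  show ?thesis
    unfolding eq
    by (intro pr_rec assms pr_add pr_compose2[OF assms(2)] pr_const pr_psnd pr_pfst pr_id)
qed

section \<open>Primitive recursive predicates\<close>

definition dec :: "(nat \<Rightarrow> bool) \<Rightarrow> bool" where
  "dec P \<longleftrightarrow> pr (\<lambda>x. of_bool (P x))"

lemma dec_const: "dec (\<lambda>x. c)"
  unfolding dec_def by (rule pr_const)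

lemma dec_not: "dec P \<Longrightarrow> dec (\<lambda>x. \<not> P x)"
proof -
  have eq: "of_bool (\<not> b) = 1 - (of_bool b :: nat)" for b
    by auto
  show "dec P \<Longrightarrow> dec (\<lambda>x. \<not> P x)"
    unfolding dec_def eq by (intro pr_diff pr_const)
qed

lemma dec_conj: "dec P \<Longrightarrow> dec Q \<Longrightarrow> dec (\<lambda>x. P x \<and> Q x)"
  unfolding dec_def of_bool_conj by (intro pr_mult)

lemma dec_disj: "dec P \<Longrightarrow> dec Q \<Longrightarrow> dec (\<lambda>x. P x \<or> Q x)"
  using dec_not[OF dec_conj[OF dec_not dec_not], of P Q] by simp

lemma dec_imp: "dec P \<Longrightarrow> dec Q \<Longrightarrow> dec (\<lambda>x. P x \<longrightarrow> Q x)"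
  unfolding imp_conv_disj by (intro dec_disj dec_not)

lemma dec_le: "pr f \<Longrightarrow> pr g \<Longrightarrow> dec (\<lambda>x. f x \<le> g x)"
proof -
  have eq: "of_bool (m \<le> n) = 1 - (m - n)" for m n :: nat
    by auto
  show "pr f \<Longrightarrow> pr g \<Longrightarrow> dec (\<lambda>x. f x \<le> g x)"
    unfolding dec_def eq by (intro pr_diff pr_const)
qed

lemma dec_less: "pr f \<Longrightarrow> pr g \<Longrightarrow> dec (\<lambda>x. f x < g x)"
  unfolding less_eq_Suc_le by (intro dec_le pr_Suc)

lemma dec_eq: "pr f \<Longrightarrow> pr g \<Longrightarrow> dec (\<lambda>x. f x = g x)"
  using dec_conj[OF dec_le dec_le, of f g g f] by (simp add: order_eq_iff[symmetric])

lemma dec_bex: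
  assumes "pr n" "dec (\<lambda>z. P (pfst z) (psnd z))"
  shows "dec (\<lambda>x. \<exists>y<n x. P x y)"
proof -
  have eq: "(\<exists>y<n x. P x y) \<longleftrightarrow> 0 < (\<Sum>y<n x. (of_bool (P x y) :: nat))" for x
    unfolding zero_less_iff_neq_zero by (subst sum_eq_0_iff) auto
  show ?thesis
    unfolding eq by (intro dec_less pr_const pr_sum assms(1) assms(2)[unfolded dec_def])
qed

lemma dec_ball:
  assumes "pr n" "dec (\<lambda>z. P (pfst z) (psnd z))"
  shows "dec (\<lambda>x. \<forall>y<n x. P x y)"
  using dec_not[OF dec_bex[OF assms(1) dec_not[OF assms(2)]]] by simp

lemma dec_subst: "dec P \<Longrightarrow> pr f \<Longrightarrow> dec (\<lambda>x. P (f x))"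
  unfolding dec_def by (rule pr_compose)

lemma dec_subst2:
  assumes "dec (\<lambda>z. P (pfst z) (psnd z))" "pr f" "pr g"
  shows "dec (\<lambda>x. P (f x) (g x))"
  using assms unfolding dec_def by (rule pr_compose2)

lemma dec_subst3:
  assumes "dec (\<lambda>z. P (pfst z) (pfst (psnd z)) (psnd (psnd z)))" "pr f" "pr g" "pr h"
  shows "dec (\<lambda>x. P (f x) (g x) (h x))"
  using dec_subst[OF assms(1) pr_pair[OF assms(2) pr_pair[OF assms(3,4)]]] by simp

lemma pr_of_bool: "dec P \<Longrightarrow> pr (\<lambda>x. of_bool (P x))"
  unfolding dec_def .

lemmas pr_intros = dec_const dec_not dec_conj dec_disj dec_imp dec_le dec_less dec_eq
  dec_bex dec_ball pr_of_bool pr_sum pr_power pr_mult pr_add pr_diff pr_pair pr_Suc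
  pr_pfst pr_psnd pr_const pr_id

subsection \<open>Computably enumerable predicates\<close>

definition cep :: "(nat \<Rightarrow> bool) \<Rightarrow> bool" where
  "cep P \<longleftrightarrow> (\<exists>Q. dec (\<lambda>z. Q (pfst z) (psnd z)) \<and> (\<forall>x. P x \<longleftrightarrow> (\<exists>y. Q x y)))"

lemma ce_iff_cep: "ce S \<longleftrightarrow> cep (\<lambda>x. x \<in> S)"
proof
  assume "ce S"
  then obtain f where f: "PRIMREC f" "S = {x. \<exists>y. f [x, y] = 0}"
    unfolding ce_def by auto
  have "PRIMREC (\<lambda>xs. f [pfst (nth0 xs 0), psnd (nth0 xs 0)])"
    using PRIMREC.comp[OF f(1), of "[\<lambda>xs. pfst (nth0 xs 0), \<lambda>xs. psnd (nth0 xs 0)]"]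
    by (simp add: PRIMREC_pfst PRIMREC_psnd PRIMREC.proj)
  then have "pr (\<lambda>z. f [pfst z, psnd z])"
    by (simp add: pr_def)
  then have "dec (\<lambda>z. f [pfst z, psnd z] = 0)"
    by (intro dec_eq pr_const)
  then show "cep (\<lambda>x. x \<in> S)"
    unfolding cep_def f(2) by (intro exI[of _ "\<lambda>x y. f [x, y] = 0"]) simp
next
  assume "cep (\<lambda>x. x \<in> S)"
  then obtain Q where Q: "dec (\<lambda>z. Q (pfst z) (psnd z))" "\<And>x. x \<in> S \<longleftrightarrow> (\<exists>y. Q x y)"
    unfolding cep_def by auto
  \<comment> \<open>\<open>ce\<close> marks a witness by the value 0, so the truth value is
    negated.\<close>
  have "pr (\<lambda>z. of_bool (\<not> Q (pfst z) (psnd z)))"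
    by (intro pr_of_bool dec_not Q(1))
  from PRIMREC_comp1[OF this[unfolded pr_def] PRIMREC_pair[OF PRIMREC.proj[of 0] PRIMREC.proj[of 1]]]
  show "ce S"
    unfolding ce_def by (intro exI conjI) (assumption, auto simp: Q(2))
qed

lemma cep_dec:
  assumes "dec P"
  shows "cep P"
  unfolding cep_def
  by (intro exI[of _ "\<lambda>x y. P x"] conjI dec_subst[OF assms] pr_pfst pr_id) auto

lemma cep_subst:
  assumes "cep P" "pr f"
  shows "cep (\<lambda>x. P (f x))"
proof -
  from assms(1) obtain Q where Q: "dec (\<lambda>z. Q (pfst z) (psnd z))" "\<And>x. P x \<longleftrightarrow> (\<exists>y. Q x y)"
    unfolding cep_def by auto
  show ?thesis
    unfolding cep_def
    by (intro exI[of _ "\<lambda>x y. Q (f x) y"] conjI dec_subst2[OF Q(1)] pr_compose[OF assms(2)]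
        pr_pfst pr_psnd pr_id) (auto simp: Q(2))
qed

lemma cep_subst2:
  assumes "cep (\<lambda>z. P (pfst z) (psnd z))" "pr f" "pr g"
  shows "cep (\<lambda>x. P (f x) (g x))"
  using cep_subst[OF assms(1) pr_pair[OF assms(2,3)]] by simp

lemma cep_ex:
  assumes "cep (\<lambda>z. P (pfst z) (psnd z))"
  shows "cep (\<lambda>x. \<exists>y. P x y)"
proof -
  from assms obtain Q where Q: "dec (\<lambda>z. Q (pfst z) (psnd z))"
      "\<And>z. P (pfst z) (psnd z) \<longleftrightarrow> (\<exists>y. Q z y)"
    unfolding cep_def by auto
  have P: "P x y \<longleftrightarrow> (\<exists>w. Q (pair x y) w)" for x y
    using Q(2)[of "pair x y"] by simp
  show ?thesis
    unfolding cep_def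
  proof (intro exI[of _ "\<lambda>x w. Q (pair x (pfst w)) (psnd w)"] conjI allI)
    show "(\<exists>y. P x y) \<longleftrightarrow> (\<exists>w. Q (pair x (pfst w)) (psnd w))" for x
      unfolding P by (metis pfst_pair psnd_pair)
  qed (intro dec_subst2[OF Q(1)] pr_intros)
qed

lemma cep_conj:
  assumes "cep P" "cep Q"
  shows "cep (\<lambda>x. P x \<and> Q x)"
proof -
  from assms obtain P' Q' where *:
    "dec (\<lambda>z. P' (pfst z) (psnd z))" "\<And>x. P x \<longleftrightarrow> (\<exists>y. P' x y)"
    "dec (\<lambda>z. Q' (pfst z) (psnd z))" "\<And>x. Q x \<longleftrightarrow> (\<exists>y. Q' x y)"
    unfolding cep_def by auto
  show ?thesis
    unfolding cep_def
  proof (intro exI[of _ "\<lambda>x w. P' x (pfst w) \<and> Q' x (psnd w)"] conjI allI)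
    show "P x \<and> Q x \<longleftrightarrow> (\<exists>w. P' x (pfst w) \<and> Q' x (psnd w))" for x
      unfolding * by (metis pfst_pair psnd_pair)
  qed (intro dec_conj dec_subst2[OF *(1)] dec_subst2[OF *(3)] pr_intros)
qed

lemma cep_disj:
  assumes "cep P" "cep Q"
  shows "cep (\<lambda>x. P x \<or> Q x)"
proof -
  from assms obtain P' Q' where *:
    "dec (\<lambda>z. P' (pfst z) (psnd z))" "\<And>x. P x \<longleftrightarrow> (\<exists>y. P' x y)"
    "dec (\<lambda>z. Q' (pfst z) (psnd z))" "\<And>x. Q x \<longleftrightarrow> (\<exists>y. Q' x y)"
    unfolding cep_def by auto
  show ?thesis
    unfolding cep_def
    by (intro exI[of _ "\<lambda>x w. P' x w \<or> Q' x w"] conjI dec_disj *(1,3)) (auto simp: *(2,4))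
qed

text \<open>Finitely many witnesses have a common bound, for instance the successor of their sum; so
  the unbounded quantifier can be moved in front of the bounded one.\<close>

lemma cep_ball:
  assumes "pr n" "cep (\<lambda>z. P (pfst z) (psnd z))"
  shows "cep (\<lambda>x. \<forall>y<n x. P x y)"
proof -
  from assms(2) obtain Q where Q: "dec (\<lambda>z. Q (pfst z) (psnd z))"
      "\<And>z. P (pfst z) (psnd z) \<longleftrightarrow> (\<exists>y. Q z y)"
    unfolding cep_def by auto
  have P: "P x y \<longleftrightarrow> (\<exists>w. Q (pair x y) w)" for x y
    using Q(2)[of "pair x y"] by simp
  show ?thesis
    unfolding cep_def
  proof (intro exI[of _ "\<lambda>x b. \<forall>y<n x. \<exists>w<b. Q (pair x y) w"] conjI allI)
    fix x
    show "(\<forall>y<n x. P x y) \<longleftrightarrow> (\<exists>b. \<forall>y<n x. \<exists>w<b. Q (pair x y) w)"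
    proof
      assume "\<forall>y<n x. P x y"
      then have "\<exists>w. \<forall>y<n x. Q (pair x y) (w y)"
        unfolding P by metis
      then obtain w where w: "\<forall>y<n x. Q (pair x y) (w y)" ..
      have "w y < Suc (\<Sum>y<n x. w y)" if "y < n x" for y
        using that member_le_sum[of y "{..<n x}" w] by (simp add: less_Suc_eq_le)
      with w show "\<exists>b. \<forall>y<n x. \<exists>w<b. Q (pair x y) w"
        by blast
    qed (auto simp: P)
  next
    show "dec (\<lambda>z. \<forall>y<n (pfst z). \<exists>w<psnd z. Q (pair (pfst z) y) w)"
      by (intro dec_ball dec_bex dec_subst2[OF Q(1)] pr_compose[OF assms(1)] pr_intros)
  qed
qed

text \<open>Stage \<open>s\<close> admits only witnesses below \<open>s\<close> and only elements
  below \<open>s\<close>. The second restriction turns quantifiers over everything enumerated by a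
  stage into bounded ones.\<close>

lemma cep_stages:
  assumes "cep P"
  obtains Q where "dec (\<lambda>z. Q (pfst z) (psnd z))" "\<And>s t x. s \<le> t \<Longrightarrow> Q s x \<Longrightarrow> Q t x"
    "\<And>s x. Q s x \<Longrightarrow> x < s" "\<And>x. P x \<longleftrightarrow> (\<exists>s. Q s x)"
proof -
  from assms(1) obtain R where R: "dec (\<lambda>z. R (pfst z) (psnd z))" "\<And>x. P x \<longleftrightarrow> (\<exists>y. R x y)"
    unfolding cep_def by auto
  show thesis
  proof (rule that)
    show "dec (\<lambda>z. psnd z < pfst z \<and> (\<exists>y<pfst z. R (psnd z) y))"
      by (intro dec_subst2[OF R(1)] pr_intros)
    show "P x \<longleftrightarrow> (\<exists>s. x < s \<and> (\<exists>y<s. R x y))" for x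
    proof (rule iffI)
      assume "P x"
      then obtain y where "R x y" using R(2) by auto
      then have "x < Suc (x + y) \<and> (\<exists>z<Suc (x + y). R x z)"
        by (auto intro!: exI[of _ y])
      then show "\<exists>s. x < s \<and> (\<exists>y<s. R x y)" ..
    qed (auto simp: R(2))
  qed (auto intro: order.strict_trans2)
qed

subsection \<open>A universal computably enumerable predicate\<close>

lemma pr_mod2: "pr f \<Longrightarrow> pr (\<lambda>x. f x mod 2)"
proof -
  have eq: "n mod 2 = rec_nat 0 (\<lambda>_ r. 1 - r) n" for n :: nat
    by (induction n) (auto simp: mod_Suc)
  show "pr f \<Longrightarrow> pr (\<lambda>x. f x mod 2)"
    unfolding eq by (intro pr_rec pr_intros)
qed

lemma pr_div2: "pr f \<Longrightarrow> pr (\<lambda>x. f x div 2)"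
proof -
  have eq: "n div 2 = rec_nat 0 (\<lambda>y r. r + y mod 2) n" for n :: nat
    by (induction n) (auto, presburger)
  show "pr f \<Longrightarrow> pr (\<lambda>x. f x div 2)"
    unfolding eq by (intro pr_rec pr_mod2 pr_intros)
qed

lemma dec_set_decode:
  assumes "pr f" "pr g"
  shows "dec (\<lambda>x. g x \<in> set_decode (f x))"
proof -
  have eq: "D div 2 ^ n = rec_nat D (\<lambda>_ r. r div 2) n" for D n :: nat
  proof (induction n)
    case (Suc n)
    then show ?case by (simp only: power_Suc2 div_mult2_eq nat.rec)
  qed simp
  have mem: "n \<in> set_decode D \<longleftrightarrow> rec_nat D (\<lambda>_ r. r div 2) n mod 2 = 1" for D n
    unfolding set_decode_def eq[symmetric] by (simp add: odd_iff_mod_2_eq_one)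
  show ?thesis
    unfolding mem by (intro dec_eq pr_mod2 pr_const pr_rec assms pr_div2 pr_psnd pr_id)
qed

lemma set_decode_less: "n \<in> set_decode D \<Longrightarrow> n < D"
proof (rule ccontr)
  assume "n \<in> set_decode D" "\<not> n < D"
  moreover have "n < 2 ^ n" by (rule less_exp)
  ultimately show False by (simp add: set_decode_def)
qed

text \<open>\<open>PRIMREC\<close> is a predicate on functions, whereas a listing needs syntax that
  can be coded by numbers. The programs act on one number, into which the argument list is
  packed.\<close>

datatype prog = PZero | PSuc | PFst | PSnd | PPair prog prog | PComp prog prog | PRec prog prog

fun run :: "prog \<Rightarrow> nat \<Rightarrow> nat" where
  "run PZero x = 0"
| "run PSuc x = Suc x"
| "run PFst x = pfst x"
| "run PSnd x = psnd x"
| "run (PPair p q) x = pair (run p x) (run q x)"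
| "run (PComp p q) x = run p (run q x)"
| "run (PRec p q) x =
     rec_nat (run p (psnd x)) (\<lambda>y r. run q (pair r (pair y (psnd x)))) (pfst x)"

fun prog_code :: "prog \<Rightarrow> nat" where
  "prog_code PZero = pair 0 0"
| "prog_code PSuc = pair 1 0"
| "prog_code PFst = pair 2 0"
| "prog_code PSnd = pair 3 0"
| "prog_code (PPair p q) = pair 4 (pair (prog_code p) (prog_code q))"
| "prog_code (PComp p q) = pair 5 (pair (prog_code p) (prog_code q))"
| "prog_code (PRec p q) = pair 6 (pair (prog_code p) (prog_code q))"

text \<open>Since the pair of zeros is coded by 0, appending zeros to a list does not change its code;
  this agrees with the convention that missing arguments default to 0.\<close>

fun args_code :: "nat list \<Rightarrow> nat" where
  "args_code [] = 0"
| "args_code (x # xs) = pair x (args_code xs)"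

lemma pfst_0 [simp]: "pfst 0 = 0" and psnd_0 [simp]: "psnd 0 = 0"
  using pfst_pair[of 0 0] psnd_pair[of 0 0] by (simp_all add: prod_encode_def)

lemma nth0_run: "\<exists>p. \<forall>xs. nth0 xs i = run p (args_code xs)"
proof (induction i)
  case 0
  have "nth0 xs 0 = run PFst (args_code xs)" for xs
    by (cases xs) auto
  then show ?case by blast
next
  case (Suc i)
  then obtain p where p: "nth0 xs i = run p (args_code xs)" for xs by blast
  have "nth0 xs (Suc i) = run (PComp p PSnd) (args_code xs)" for xs
    using p[of "[]"] by (cases xs) (auto simp: p[symmetric])
  then show ?case by blast
qed

lemma PRIMREC_run: "PRIMREC f \<Longrightarrow> \<exists>p. \<forall>xs. f xs = run p (args_code xs)"
proof (induction rule: PRIMREC.induct)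
  case zero
  show ?case by (rule exI[of _ PZero]) simp
next
  case suc
  have "Suc (hd0 xs) = run (PComp PSuc PFst) (args_code xs)" for xs
    by (cases xs) auto
  then show ?case by blast
next
  case (proj i)
  show ?case by (rule nth0_run)
next
  case (comp g fs)
  then obtain p where p: "g xs = run p (args_code xs)" for xs by blast
  have "\<forall>f\<in>set fs. \<exists>p. \<forall>xs. f xs = run p (args_code xs)"
    using comp by blast
  then have "\<exists>q. \<forall>xs. args_code (map (\<lambda>f. f xs) fs) = run q (args_code xs)"
  proof (induction fs)
    case Nil
    show ?case by (rule exI[of _ PZero]) simp
  next
    case (Cons f fs)
    then obtain q1 q2 where "\<forall>xs. f xs = run q1 (args_code xs)"
        "\<forall>xs. args_code (map (\<lambda>f. f xs) fs) = run q2 (args_code xs)"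
      by auto
    then show ?case by (intro exI[of _ "PPair q1 q2"]) simp
  qed
  then obtain q where "\<forall>xs. args_code (map (\<lambda>f. f xs) fs) = run q (args_code xs)" ..
  then show ?case by (intro exI[of _ "PComp p q"]) (simp add: p)
next
  case (prec f g)
  then obtain p q where pq: "f xs = run p (args_code xs)" "g xs = run q (args_code xs)" for xs
    by blast
  have "PREC f g xs = run (PRec p q) (args_code xs)" for xs
    by (cases xs) (auto simp: pq)
  then show ?case by blast
qed

abbreviation triple :: "nat \<Rightarrow> nat \<Rightarrow> nat \<Rightarrow> nat" where
  "triple e x v \<equiv> pair e (pair x v)"

text \<open>The triples in S are claims that program e maps x to v. In a set where every claim is justified
  by other claims all of them are true, by induction on the program; circularity is harmless because
  a justification only appeals to subprograms or to a smaller recursion argument.\<close>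

definition justified :: "nat set \<Rightarrow> nat \<Rightarrow> nat \<Rightarrow> nat \<Rightarrow> bool" where
  "justified S e x v \<longleftrightarrow>
     (pfst e = 0 \<and> v = 0) \<or> (pfst e = 1 \<and> v = Suc x) \<or>
     (pfst e = 2 \<and> v = pfst x) \<or> (pfst e = 3 \<and> v = psnd x) \<or>
     (pfst e = 4 \<and> triple (pfst (psnd e)) x (pfst v) \<in> S \<and> triple (psnd (psnd e)) x (psnd v) \<in> S) \<or>
     (pfst e = 5 \<and> (\<exists>a. triple (psnd (psnd e)) x a \<in> S \<and> triple (pfst (psnd e)) a v \<in> S)) \<or>
     (pfst e = 6 \<and> pfst x = 0 \<and> triple (pfst (psnd e)) (psnd x) v \<in> S) \<or>
     (pfst e = 6 \<and> 0 < pfst x \<and> (\<exists>r. triple e (pair (pfst x - 1) (psnd x)) r \<in> S \<and>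
        triple (psnd (psnd e)) (pair r (pair (pfst x - 1) (psnd x))) v \<in> S))"

definition self_justified :: "nat set \<Rightarrow> bool" where
  "self_justified S \<longleftrightarrow> (\<forall>t\<in>S. justified S (pfst t) (pfst (psnd t)) (psnd (psnd t)))"

lemma self_justifiedD: "self_justified S \<Longrightarrow> triple e x v \<in> S \<Longrightarrow> justified S e x v"
  unfolding self_justified_def by force

text \<open>\<open>S\<close> occurs only positively, so tables of subcomputations can be
  merged.\<close>

lemma justified_mono: "S \<subseteq> S' \<Longrightarrow> justified S e x v \<Longrightarrow> justified S' e x v"
  unfolding justified_def by blast

lemma self_justified_Un: "self_justified S \<Longrightarrow> self_justified S' \<Longrightarrow> self_justified (S \<union> S')"
  unfolding self_justified_def by (blast intro: justified_mono[of S] justified_mono[of S'])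

lemma self_justified_extend:
  assumes "finite S" "self_justified S" "justified S e x v"
  shows "\<exists>S. finite S \<and> self_justified S \<and> triple e x v \<in> S"
proof (intro exI conjI)
  show "self_justified (insert (triple e x v) S)"
    using assms(2,3) unfolding self_justified_def
    by (auto intro: justified_mono[OF subset_insertI])
qed (use assms(1) in auto)

lemma run_if_self_justified:
  assumes S: "self_justified S"
  shows "triple (prog_code p) x v \<in> S \<Longrightarrow> run p x = v"
proof (induction p arbitrary: x v)
  case (PPair p q)
  then show ?case
    using self_justifiedD[OF S PPair.prems] by (auto simp: justified_def)
next
  case (PComp p q)
  then show ?case
    using self_justifiedD[OF S PComp.prems] by (auto simp: justified_def)
next
  case (PRec p q)
  have "triple (prog_code (PRec p q)) (pair n w) v \<in> S \<Longrightarrow> run (PRec p q) (pair n w) = v" for n w v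
  proof (induction n arbitrary: v)
    case 0
    then show ?case
      using self_justifiedD[OF S 0] PRec.IH(1) by (auto simp: justified_def)
  next
    case (Suc n)
    then obtain r where r: "triple (prog_code (PRec p q)) (pair n w) r \<in> S"
        "triple (prog_code q) (pair r (pair n w)) v \<in> S"
      using self_justifiedD[OF S Suc.prems] by (auto simp: justified_def)
    from Suc.IH[OF r(1)] PRec.IH(2)[OF r(2)] show ?case by simp
  qed
  from this[of "pfst x" "psnd x"] PRec.prems show ?case by simp
qed (use self_justifiedD[OF S] in \<open>fastforce simp: justified_def\<close>)+

text \<open>Completeness of tables: the tables of the subcomputations are merged and one claim is
  added. Recursion needs a second induction, on the counter.\<close>

lemma self_justified_run:
  "\<exists>S. finite S \<and> self_justified S \<and> triple (prog_code p) x (run p x) \<in> S"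
proof (induction p arbitrary: x)
  case (PPair p q)
  obtain S1 S2 where S: "finite S1" "self_justified S1" "triple (prog_code p) x (run p x) \<in> S1"
      "finite S2" "self_justified S2" "triple (prog_code q) x (run q x) \<in> S2"
    using PPair.IH by meson
  have "justified (S1 \<union> S2) (prog_code (PPair p q)) x (run (PPair p q) x)"
    using S by (simp add: justified_def)
  from self_justified_extend[OF _ self_justified_Un[OF S(2,5)] this] S(1,4) show ?case
    by simp
next
  case (PComp p q)
  obtain S1 S2 where S: "finite S1" "self_justified S1" "triple (prog_code p) (run q x) (run p (run q x)) \<in> S1"
      "finite S2" "self_justified S2" "triple (prog_code q) x (run q x) \<in> S2"
    using PComp.IH by meson
  have "justified (S1 \<union> S2) (prog_code (PComp p q)) x (run (PComp p q) x)"
    using S by (auto simp: justified_def)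
  from self_justified_extend[OF _ self_justified_Un[OF S(2,5)] this] S(1,4) show ?case
    by simp
next
  case (PRec p q)
  let ?e = "prog_code (PRec p q)" and ?r = "run (PRec p q)"
  have "\<exists>S. finite S \<and> self_justified S \<and> triple ?e (pair n w) (?r (pair n w)) \<in> S" for n w
  proof (induction n)
    case 0
    obtain S where S: "finite S" "self_justified S" "triple (prog_code p) w (run p w) \<in> S"
      using PRec.IH by meson
    have "justified S ?e (pair 0 w) (?r (pair 0 w))"
      using S by (simp add: justified_def)
    from self_justified_extend[OF S(1,2) this] show ?case .
  next
    case (Suc n)
    let ?y = "pair (?r (pair n w)) (pair n w)"
    obtain S1 S2 where S: "finite S1" "self_justified S1" "triple ?e (pair n w) (?r (pair n w)) \<in> S1"
        "finite S2" "self_justified S2" "triple (prog_code q) ?y (run q ?y) \<in> S2"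
      using Suc.IH PRec.IH(2)[of ?y] by meson
    have "justified (S1 \<union> S2) ?e (pair (Suc n) w) (?r (pair (Suc n) w))"
      using S by (auto simp: justified_def)
    from self_justified_extend[OF _ self_justified_Un[OF S(2,5)] this] S(1,4) show ?case
      by simp
  qed
  from this[of "pfst x" "psnd x"] show ?case by simp
qed (rule self_justified_extend[of "{}"]; simp add: self_justified_def justified_def)+

text \<open>The table is the set of binary digits of \<open>D\<close>, so that searching for it is a
  number quantifier. Members are smaller than \<open>D\<close>, hence \<open>t<D\<close> reaches all
  of them. The disjunction replaces an implication because \<open>justified\<close> is only shown to
  be c.e., while its alternative is decidable.\<close>

definition evaluates :: "nat \<Rightarrow> nat \<Rightarrow> nat \<Rightarrow> bool" where
  "evaluates e x v \<longleftrightarrow> (\<exists>D. triple e x v \<in> set_decode D \<and> (\<forall>t<D. t \<notin> set_decode D \<or>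
     justified (set_decode D) (pfst t) (pfst (psnd t)) (psnd (psnd t))))"

lemma evaluates_prog_code: "evaluates (prog_code p) x v \<longleftrightarrow> run p x = v"
proof -
  have *: "(\<forall>t<D. t \<notin> set_decode D \<or>
      justified (set_decode D) (pfst t) (pfst (psnd t)) (psnd (psnd t))) \<longleftrightarrow>
      self_justified (set_decode D)" for D
    unfolding self_justified_def using set_decode_less by blast
  show ?thesis
    unfolding evaluates_def *
  proof
    assume "run p x = v"
    then obtain S where "finite S" "self_justified S" "triple (prog_code p) x v \<in> S"
      using self_justified_run by blast
    then show "\<exists>D. triple (prog_code p) x v \<in> set_decode D \<and> self_justified (set_decode D)"
      by (intro exI[of _ "set_encode S"]) simp
  qed (auto intro: run_if_self_justified)
qed

lemma cep_justified:
  assumes "pr D" "pr e" "pr x" "pr v"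
  shows "cep (\<lambda>z. justified (set_decode (D z)) (e z) (x z) (v z))"
  unfolding justified_def
  by (intro cep_disj cep_conj cep_ex; rule cep_dec;
      intro pr_intros dec_set_decode pr_compose[OF assms(1)] pr_compose[OF assms(2)]
        pr_compose[OF assms(3)] pr_compose[OF assms(4)] assms)

text \<open>\<open>pair x (pair y 0)\<close> codes the list \<open>[x, y]\<close>. Numbers
  \<open>e\<close> that code no program merely contribute further c.e. predicates to the
  list.\<close>

definition univ_ce :: "nat \<Rightarrow> nat \<Rightarrow> bool" where
  "univ_ce e x \<longleftrightarrow> (\<exists>y. evaluates e (pair x (pair y 0)) 0)"

lemma cep_univ_ce: "cep (\<lambda>z. univ_ce (pfst z) (psnd z))"
  unfolding univ_ce_def evaluates_def
  by (intro cep_conj cep_ex cep_ball cep_disj cep_justified cep_dec[OF dec_set_decode]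
      cep_dec[OF dec_not[OF dec_set_decode]] pr_intros)

lemma univ_ce_universal:
  assumes "cep P"
  shows "\<exists>e. \<forall>x. P x \<longleftrightarrow> univ_ce e x"
proof -
  have "ce (Collect P)"
    using assms by (simp add: ce_iff_cep)
  then obtain f where "PRIMREC f" and f: "Collect P = {x. \<exists>y. f [x, y] = 0}"
    unfolding ce_def by auto
  then obtain p where "f xs = run p (args_code xs)" for xs
    using PRIMREC_run by blast
  then have "P x \<longleftrightarrow> univ_ce (prog_code p) x" for x
    using f by (auto simp: univ_ce_def evaluates_prog_code set_eq_iff)
  then show ?thesis by blast
qed

subsection \<open>Binary strings\<close>

text \<open>Strings are read as numerals with digits 1 and 2, lowest digit first, so an appended
  string occupies the higher places.\<close>

lemma str_code_append: "str_code (s @ t) = str_code s + 2 ^ length s * str_code t"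
  by (induction s) (auto simp: algebra_simps)

lemma str_code_inject: "str_code s = str_code t \<longleftrightarrow> s = t"
proof (induction s arbitrary: t)
  case Nil
  show ?case by (cases t) auto
next
  case (Cons b s)
  show ?case
  proof (cases t)
    case (Cons c u)
    have "2 * m + (if b then 2 else 1) = 2 * n + (if c then 2 else 1) \<longleftrightarrow> m = n \<and> b = c" for m n :: nat
      by (cases b; cases c) (auto, presburger+)
    with Cons.IH show ?thesis
      using Cons by auto
  qed auto
qed

lemma surj_str_code: "\<exists>s. str_code s = n"
proof (induction n rule: less_induct)
  case (less n)
  show ?case
  proof (cases "n = 0")
    case False
    \<comment> \<open>The lowest digit is 2 for even \<open>n\<close> and 1 for odd
      \<open>n\<close>; in both cases \<open>?m\<close> codes what remains.\<close>
    let ?m = "(n - 1) div 2"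
    have "?m < n" using False by simp
    from less[OF this] obtain s where s: "str_code s = ?m" ..
    have "str_code (even n # s) = n"
      using False by (auto simp: s elim: evenE oddE)
    then show ?thesis ..
  qed (auto intro: exI[of _ "[]"])
qed

definition str_of :: "nat \<Rightarrow> bool list" where
  "str_of n = inv str_code n"

lemma str_code_str_of [simp]: "str_code (str_of n) = n"
  unfolding str_of_def by (rule surj_f_inv_f) (metis surj_str_code surj_def)

lemma str_of_str_code [simp]: "str_of (str_code s) = s"
  by (simp add: str_code_inject[symmetric])

lemma str_code_bounds: "2 ^ length s \<le> Suc (str_code s)" "Suc (str_code s) < 2 ^ Suc (length s)"
  by (induction s) auto

lemma length_le_str_code: "length s \<le> str_code s"
  by (induction s) auto

text \<open>The length is the integer part of log2(c+1), written as a bounded count so that it is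
  visibly primitive recursive.\<close>

lemma length_str_of: "length (str_of c) = (\<Sum>n<c. of_bool (2 ^ Suc n \<le> Suc c))"
proof -
  let ?l = "length (str_of c)"
  have "2 ^ Suc n \<le> Suc c \<longleftrightarrow> n < ?l" for n
  proof
    assume "2 ^ Suc n \<le> Suc c"
    then have "(2::nat) ^ Suc n < 2 ^ Suc ?l"
      using str_code_bounds(2)[of "str_of c"] by (simp only: str_code_str_of order.strict_trans1)
    then show "n < ?l" by simp
  next
    assume "n < ?l"
    then have "(2::nat) ^ Suc n \<le> 2 ^ ?l"
      by (intro power_increasing) auto
    then show "2 ^ Suc n \<le> Suc c"
      using str_code_bounds(1)[of "str_of c"] by simp
  qed
  then have "(\<Sum>n<c. of_bool (2 ^ Suc n \<le> Suc c)) = (\<Sum>n<c. of_bool (n < ?l) :: nat)"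
    by presburger
  also have "{..<c} \<inter> {n. n < ?l} = {..<?l}"
    using length_le_str_code[of "str_of c"] by auto
  then have "(\<Sum>n<c. of_bool (n < ?l) :: nat) = ?l"
    by (simp add: sum_of_bool_eq)
  finally show ?thesis by simp
qed

text \<open>By \<open>str_code_append\<close> the witness \<open>r\<close> is the code of the
  remaining string; it is at most \<open>b\<close>, which makes the prefix relation
  decidable.\<close>

lemma prefix_str_of:
  "prefix (str_of a) (str_of b) \<longleftrightarrow> (\<exists>r<Suc b. b = a + 2 ^ length (str_of a) * r)"
proof
  assume "prefix (str_of a) (str_of b)"
  then obtain u where "str_of b = str_of a @ u" by (auto simp: prefix_def)
  from arg_cong[OF this, of str_code] have b: "b = a + 2 ^ length (str_of a) * str_code u"
    by (simp add: str_code_append)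
  moreover have "str_code u \<le> 2 ^ length (str_of a) * str_code u" by simp
  ultimately show "\<exists>r<Suc b. b = a + 2 ^ length (str_of a) * r"
    by (intro exI[of _ "str_code u"]) linarith
next
  assume "\<exists>r<Suc b. b = a + 2 ^ length (str_of a) * r"
  then obtain r where "b = a + 2 ^ length (str_of a) * r" by blast
  then have "str_code (str_of b) = str_code (str_of a @ str_of r)"
    by (simp add: str_code_append)
  then show "prefix (str_of a) (str_of b)"
    by (simp add: str_code_inject)
qed

lemma pr_length: "pr f \<Longrightarrow> pr (\<lambda>x. length (str_of (f x)))"
proof -
  assume f: "pr f"
  show "pr (\<lambda>x. length (str_of (f x)))"
    unfolding length_str_of by (intro pr_intros f pr_compose[OF f])
qed

lemma dec_prefix:
  assumes "pr f" "pr g"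
  shows "dec (\<lambda>x. prefix (str_of (f x)) (str_of (g x)))"
  unfolding prefix_str_of
  by (intro pr_intros pr_length assms pr_compose[OF assms(1)] pr_compose[OF assms(2)])

lemma str_of_less:
  assumes "length (str_of r) \<le> n"
  shows "r < 2 ^ Suc n"
proof -
  have "Suc r < 2 ^ Suc (length (str_of r))"
    using str_code_bounds(2)[of "str_of r"] by (simp only: str_code_str_of)
  also have "\<dots> \<le> 2 ^ Suc n"
    using assms by (intro power_increasing) auto
  finally show ?thesis by (rule Suc_lessD)
qed

lemma all_length_iff:
  "(\<forall>r. length r = n \<longrightarrow> Q r) \<longleftrightarrow> (\<forall>r<2 ^ Suc n. length (str_of r) = n \<longrightarrow> Q (str_of r))"
proof (intro iffI allI impI)
  fix r :: "bool list" assume Q: "\<forall>r<2 ^ Suc n. length (str_of r) = n \<longrightarrow> Q (str_of r)" and r: "length r = n"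
  have "str_code r < 2 ^ Suc n"
    using r by (intro str_of_less) simp
  from Q[rule_format, OF this] r show "Q r" by simp
qed blast

subsection \<open>Open sets generated by strings\<close>

definition restr :: "(nat \<Rightarrow> bool) \<Rightarrow> nat \<Rightarrow> bool list" where
  "restr X n = map X [0..<n]"

lemma length_restr [simp]: "length (restr X n) = n"
  by (simp add: restr_def)

lemma mem_cyl_iff: "X \<in> cyl s \<longleftrightarrow> restr X (length s) = s"
  unfolding restr_def list_eq_iff_nth_eq by (simp add: cyl_def)

lemma take_restr: "m \<le> n \<Longrightarrow> take m (restr X n) = restr X m"
  by (simp add: restr_def take_map)

lemma mem_cyl_restr [simp]: "X \<in> cyl (restr X n)"
  by (simp add: mem_cyl_iff)

lemma prefix_restr: "length s \<le> n \<Longrightarrow> prefix s (restr X n) \<longleftrightarrow> X \<in> cyl s"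
  by (metis append_eq_conv_conj length_restr mem_cyl_iff prefix_def take_is_prefix take_restr)

lemma cyl_mono: "prefix s t \<Longrightarrow> cyl t \<subseteq> cyl s"
  using prefix_restr prefix_length_le by (metis mem_cyl_iff subsetI)

lemma prefix_of_mem_cyl: "X \<in> cyl s \<Longrightarrow> X \<in> cyl t \<Longrightarrow> length s \<le> length t \<Longrightarrow> prefix s t"
  by (metis mem_cyl_iff prefix_restr)

definition gen_open :: "(bool list \<Rightarrow> bool) \<Rightarrow> (nat \<Rightarrow> bool) set" where
  "gen_open G = (\<Union>s\<in>Collect G. cyl s)"

lemma mem_gen_open: "X \<in> gen_open G \<longleftrightarrow> (\<exists>s. G s \<and> X \<in> cyl s)"
  by (auto simp: gen_open_def)

lemma koenig:
  assumes "B s" "\<And>t. B t \<Longrightarrow> \<exists>b. B (t @ [b])"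
  shows "\<exists>X\<in>cyl s. \<forall>n\<ge>length s. B (restr X n)"
proof -
  obtain c where c: "B t \<Longrightarrow> B (t @ [c t])" for t
    using assms(2) by metis
  define path where "path = rec_nat s (\<lambda>_ t. t @ [c t])"
  have path: "path 0 = s" "path (Suc k) = path k @ [c (path k)]" for k
    by (simp_all add: path_def)
  have len: "length (path k) = length s + k" for k
    by (induction k) (auto simp: path)
  have B: "B (path k)" for k
    by (induction k) (auto simp: path assms(1) c)
  have pre: "prefix (path k) (path (k + m))" for k m
    by (induction m) (auto simp: path intro: prefix_order.trans)
  \<comment> \<open>\<open>path (Suc i)\<close> is longer than \<open>i\<close>, whatever the length
    of \<open>s\<close>, and all later strings extend it.\<close>
  define X where "X i = path (Suc i) ! i" for i
  have "restr X (length s + k) = path k" for k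
  proof (rule nth_equalityI)
    fix i assume "i < length (restr X (length s + k))"
    then have i: "i < length (path k)" "i < length (path (Suc i))"
      by (auto simp: len)
    have "path (Suc i) ! i = path k ! i"
      using pre[of k "Suc i - k"] pre[of "Suc i" "k - Suc i"] i
      by (cases "k \<le> Suc i") (auto simp: prefix_def nth_append)
    then show "restr X (length s + k) ! i = path k ! i"
      using i by (simp add: X_def restr_def len)
  qed (simp add: len)
  then have X: "restr X n = path (n - length s)" if "length s \<le> n" for n
    using that by (metis le_add_diff_inverse)
  show ?thesis
    by (rule bexI[of _ X]) (auto simp: X B mem_cyl_iff path)
qed

text \<open>Compactness of Cantor space, in a form that can be enumerated. If both one-bit
  extensions of a string are covered at some level, the string is covered at the larger level. An
  uncovered string would therefore start a path of uncovered strings, but the limit of the path lies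
  in a generating cylinder, which covers one of its restrictions.\<close>

lemma cyl_subset_gen_open_iff:
  "cyl s \<subseteq> gen_open G \<longleftrightarrow>
     (\<exists>n. length s \<le> n \<and> (\<forall>r. length r = n \<and> prefix s r \<longrightarrow> (\<exists>t. G t \<and> prefix t r)))"
  (is "_ \<longleftrightarrow> ?cov s")
proof
  assume sub: "cyl s \<subseteq> gen_open G"
  have step: "?cov t" if cov: "\<And>b. ?cov (t @ [b])" for t
  proof -
    obtain n where n: "length (t @ [b]) \<le> n b"
      "length r = n b \<Longrightarrow> prefix (t @ [b]) r \<Longrightarrow> \<exists>u. G u \<and> prefix u r" for b r
      using cov by metis
    define m where "m = max (n True) (n False)"
    have m: "n b \<le> m" for b
      by (cases b) (auto simp: m_def)
    show ?thesis
    proof (intro exI[of _ m] conjI allI impI)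
      show "length t \<le> m" using n(1)[of True] m[of True] by simp
      fix r assume r: "length r = m \<and> prefix t r"
      then have "length t < length r" using n(1)[of True] m[of True] by simp
      with r obtain b where b: "prefix (t @ [b]) r"
        by (metis append_one_prefix)
      have "prefix (t @ [b]) (take (n b) r)"
        using b n(1)[of b] by (auto simp: prefix_def take_Cons' split: if_splits)
      moreover have "length (take (n b) r) = n b"
        using r m[of b] by simp
      ultimately obtain u where "G u" "prefix u (take (n b) r)" using n(2) by blast
      then show "\<exists>u. G u \<and> prefix u r"
        using take_is_prefix prefix_order.trans by blast
    qed
  qed
  show "?cov s"
  proof (rule ccontr)
    assume "\<not> ?cov s"
    then obtain X where X: "X \<in> cyl s" "\<And>n. length s \<le> n \<Longrightarrow> \<not> ?cov (restr X n)"
      using koenig[of "\<lambda>t. \<not> ?cov t" s] step by blast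
    from sub X(1) have "X \<in> gen_open G" by (rule subsetD)
    then obtain t where t: "G t" "X \<in> cyl t"
      unfolding mem_gen_open by blast
    let ?n = "max (length s) (length t)"
    have "prefix t (restr X ?n)"
      using t(2) by (simp add: prefix_restr)
    then have "?cov (restr X ?n)"
      using t(1) by (intro exI[of _ ?n]) (auto simp: prefix_def)
    moreover have "\<not> ?cov (restr X ?n)"
      by (rule X(2)) simp
    ultimately show False by (rule notE[rotated])
  qed
next
  assume "?cov s"
  then obtain n where n: "length s \<le> n"
    "\<And>r. length r = n \<Longrightarrow> prefix s r \<Longrightarrow> \<exists>t. G t \<and> prefix t r" by blast
  show "cyl s \<subseteq> gen_open G"
  proof
    fix X assume "X \<in> cyl s"
    then obtain t where "G t" "prefix t (restr X n)"
      using n prefix_restr by (metis length_restr)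
    then show "X \<in> gen_open G"
      using mem_gen_open prefix_restr prefix_length_le by (metis length_restr)
  qed
qed

text \<open>Effective openness asks for an enumeration of all contained cylinders; compactness
  obtains it from an enumeration of generators.\<close>

lemma unif_eff_open_gen_open:
  assumes "cep (\<lambda>z. G (pfst z) (str_of (psnd z)))"
  shows "unif_eff_open (\<lambda>i. gen_open (G i))"
proof -
  \<comment> \<open>Strings of length \<open>n\<close> have codes below \<open>2 ^ Suc n\<close>;
    the premise of the implication is decidable, so it may be negated into a disjunction.\<close>
  have bounded: "(\<forall>r. length r = n \<and> prefix (str_of c) r \<longrightarrow> (\<exists>t. G i t \<and> prefix t r)) \<longleftrightarrow>
      (\<forall>r<2 ^ Suc n. \<not> (length (str_of r) = n \<and> prefix (str_of c) (str_of r)) \<or>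
        (\<exists>t. G i (str_of t) \<and> prefix (str_of t) (str_of r)))" (is "?L \<longleftrightarrow> ?R") for i c n
  proof
    assume ?L
    then show ?R by (metis str_of_str_code)
  next
    assume R: ?R
    show ?L
    proof (intro allI impI)
      fix r assume r: "length r = n \<and> prefix (str_of c) r"
      then have "str_code r < 2 ^ Suc n"
        by (intro str_of_less) simp
      with R r show "\<exists>t. G i t \<and> prefix t r"
        by (metis str_of_str_code)
    qed
  qed
  have "{pair i (str_code s) |i s. cyl s \<subseteq> gen_open (G i)} =
      {z. cyl (str_of (psnd z)) \<subseteq> gen_open (G (pfst z))}"
  proof (intro set_eqI iffI)
    fix z assume "z \<in> {z. cyl (str_of (psnd z)) \<subseteq> gen_open (G (pfst z))}"
    then show "z \<in> {pair i (str_code s) |i s. cyl s \<subseteq> gen_open (G i)}"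
      by (intro CollectI exI[of _ "pfst z"] exI[of _ "str_of (psnd z)"]) simp
  qed auto
  moreover have "cep (\<lambda>z. cyl (str_of (psnd z)) \<subseteq> gen_open (G (pfst z)))"
    unfolding cyl_subset_gen_open_iff bounded
    by (intro cep_ex cep_conj cep_ball cep_disj cep_subst2[OF assms] cep_dec[OF dec_le]
        cep_dec[OF dec_prefix] cep_dec[OF dec_not[OF dec_conj[OF dec_eq dec_prefix]]] pr_length pr_intros)
  moreover have "gen_open (G i) = \<Union>{cyl s |s. cyl s \<subseteq> gen_open (G i)}" for i
    unfolding gen_open_def by blast
  ultimately show ?thesis
    unfolding unif_eff_open_def by (simp add: ce_iff_cep)
qed

text \<open>The contained cylinders are themselves a c.e. family of generators. This reduces the
  competitors to indices of \<open>univ_ce\<close>.\<close>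

lemma unif_eff_open_index:
  assumes "unif_eff_open U"
  shows "\<exists>e. \<forall>i. U i = gen_open (\<lambda>s. univ_ce e (pair i (str_code s)))"
proof -
  have "cep (\<lambda>x. x \<in> {pair i (str_code s) |i s. cyl s \<subseteq> U i})"
    using assms by (simp add: unif_eff_open_def ce_iff_cep)
  then obtain e where "x \<in> {pair i (str_code s) |i s. cyl s \<subseteq> U i} \<longleftrightarrow> univ_ce e x" for x
    using univ_ce_universal by blast
  then have e: "univ_ce e (pair i (str_code s)) \<longleftrightarrow> cyl s \<subseteq> U i" for i s
    by (force simp: str_code_inject)
  have "U i = gen_open (\<lambda>s. cyl s \<subseteq> U i)" for i
  proof -
    have "U i = \<Union>{cyl s |s. cyl s \<subseteq> U i}"
      using assms unfolding unif_eff_open_def by blast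
    also have "\<dots> = gen_open (\<lambda>s. cyl s \<subseteq> U i)"
      unfolding gen_open_def by blast
    finally show ?thesis .
  qed
  then show ?thesis
    by (intro exI[of _ e]) (simp add: e)
qed

subsection \<open>Measure of open sets\<close>

lemma prob_space_lam: "prob_space lam"
  unfolding lam_def by (intro prob_space_PiM measure_pmf.prob_space_axioms)

interpretation lam: prob_space lam
  by (rule prob_space_lam)

lemma emeasure_cyl: "emeasure lam (cyl s) = ennreal ((1 / 2) ^ length s)"
proof -
  interpret product_prob_space "\<lambda>_::nat. measure_pmf (bernoulli_pmf (1/2))" UNIV ..
  have "cyl s = {X \<in> space lam. \<forall>i\<in>{..<length s}. X i \<in> {s ! i}}"
    by (auto simp: cyl_def lam_def space_PiM)
  then have "emeasure lam (cyl s) = (\<Prod>i<length s. emeasure (measure_pmf (bernoulli_pmf (1/2))) {s ! i})"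
    unfolding lam_def by (simp only:) (rule emeasure_PiM_Collect, auto)
  also have "\<dots> = (\<Prod>i<length s. ennreal (1 / 2))"
    by (intro prod.cong refl) (auto simp: emeasure_pmf_single)
  also have "\<dots> = ennreal ((1 / 2) ^ length s)"
    by (simp only: prod_constant card_lessThan) (rule ennreal_power, simp)
  finally show ?thesis .
qed

text \<open>\<open>emeasure\<close> vanishes outside the sigma-algebra, so the positive value of
  \<open>emeasure_cyl\<close> already forces measurability.\<close>

lemma sets_cyl [measurable, simp]: "cyl s \<in> sets lam"
proof (rule ccontr)
  assume "cyl s \<notin> sets lam"
  then have "emeasure lam (cyl s) = 0" by (rule emeasure_notin_sets)
  then show False by (simp add: emeasure_cyl)
qed

lemma sets_gen_open [measurable, simp]: "gen_open G \<in> sets lam"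
  unfolding gen_open_def by (intro sets.countable_UN'') auto

lemma measure_cyl: "measure lam (cyl s) = (1 / 2) ^ length s"
  unfolding measure_def emeasure_cyl by (rule enn2real_ennreal) simp

lemma measure_cyls_same_length:
  assumes "\<And>s. s \<in> B \<Longrightarrow> length s = n"
  shows "measure lam (\<Union>s\<in>B. cyl s) = card B * (1 / 2) ^ n"
proof -
  have fin: "finite B"
    using assms by (intro finite_subset[OF _ finite_lists_length_eq[of UNIV n]]) auto
  have "disjoint_family_on cyl B"
    unfolding disjoint_family_on_def
  proof (intro ballI impI)
    fix s t assume "s \<in> B" "t \<in> B" "s \<noteq> t"
    then show "cyl s \<inter> cyl t = {}"
      using assms by (auto simp: mem_cyl_iff)
  qed
  then have "measure lam (\<Union>s\<in>B. cyl s) = (\<Sum>s\<in>B. measure lam (cyl s))"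
    using fin by (intro lam.finite_measure_finite_Union) auto
  also have "\<dots> = card B * (1 / 2) ^ n"
    using assms by (simp add: measure_cyl)
  finally show ?thesis .
qed

lemma measure_mono: "A \<subseteq> B \<Longrightarrow> B \<in> sets lam \<Longrightarrow> measure lam A \<le> measure lam B"
  by (rule lam.finite_measure_mono)

text \<open>All generators can be refined to the common length \<open>s\<close>, where cylinders are
  disjoint. The count is a bounded sum over codes, so measures of finite stages become
  computable.\<close>

lemma measure_gen_open_bounded_length:
  assumes "\<And>t. G t \<Longrightarrow> length t \<le> s"
  shows "measure lam (gen_open G) =
    (\<Sum>r<2 ^ Suc s. of_bool (length (str_of r) = s \<and> (\<exists>t. G t \<and> prefix t (str_of r))) :: nat) * (1 / 2) ^ s"
    (is "_ = ?c * _")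
proof -
  let ?B = "{r. length r = s \<and> (\<exists>t. G t \<and> prefix t r)}"
  have "gen_open G = (\<Union>r\<in>?B. cyl r)"
  proof (intro set_eqI iffI)
    fix X assume "X \<in> gen_open G"
    then obtain t where "G t" "X \<in> cyl t" unfolding mem_gen_open by blast
    then have "restr X s \<in> ?B"
      using assms prefix_restr by auto
    then show "X \<in> (\<Union>r\<in>?B. cyl r)" using mem_cyl_restr by blast
  next
    fix X assume "X \<in> (\<Union>r\<in>?B. cyl r)"
    then obtain r t where "X \<in> cyl r" "G t" "prefix t r" by blast
    then show "X \<in> gen_open G"
      unfolding mem_gen_open using cyl_mono by blast
  qed
  moreover have "measure lam (\<Union>r\<in>?B. cyl r) = card ?B * (1 / 2) ^ s"
    by (rule measure_cyls_same_length) simp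
  moreover have "card ?B = ?c"
  proof -
    let ?C = "{..<2 ^ Suc s} \<inter> {r. str_of r \<in> ?B}"
    have "bij_betw str_of ?C ?B"
    proof (rule bij_betw_byWitness[where f' = str_code])
      show "str_code ` ?B \<subseteq> ?C"
        using str_of_less[of "str_code _" s] by auto
    qed auto
    then have "card ?B = card ?C" by (simp add: bij_betw_same_card)
    also have "\<dots> = ?c"
      by (simp add: sum_of_bool_eq)
    finally show ?thesis .
  qed
  ultimately show ?thesis by simp
qed

text \<open>Only indices at which the bound is known enter the union. Each finite part lies in the
  set with the largest such index, and continuity from below passes to the limit.\<close>

lemma measure_UN_incseq_le:
  assumes "incseq D" "\<And>n. D n \<in> sets lam" "\<And>n. n \<in> N \<Longrightarrow> measure lam (D n) \<le> c" "0 \<le> c"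
  shows "measure lam (\<Union>n\<in>N. D n) \<le> c"
proof -
  define E where "E n = (\<Union>m\<in>N \<inter> {..n}. D m)" for n
  have "measure lam (E n) \<le> c" for n
  proof (cases "N \<inter> {..n} = {}")
    case False
    let ?m = "Max (N \<inter> {..n})"
    have m: "?m \<in> N \<inter> {..n}"
      using False by (intro Max_in) auto
    have "E n \<subseteq> D ?m"
      unfolding E_def using incseqD[OF assms(1)] by (intro UN_least) auto
    then have "measure lam (E n) \<le> measure lam (D ?m)"
      using assms(2) by (rule measure_mono)
    also have "\<dots> \<le> c" using m assms(3) by blast
    finally show ?thesis .
  qed (use assms(4) in \<open>simp add: E_def\<close>)
  moreover have "(\<lambda>n. measure lam (E n)) \<longlonglongrightarrow> measure lam (\<Union>n. E n)"
  proof (rule lam.finite_Lim_measure_incseq)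
    show "incseq E"
      unfolding E_def by (intro monoI UN_mono) auto
    show "range E \<subseteq> sets lam"
      unfolding E_def using assms(2) by auto
  qed
  moreover have "(\<Union>n. E n) = (\<Union>n\<in>N. D n)"
    by (auto simp: E_def)
  ultimately show ?thesis
    using LIMSEQ_le_const2 by (metis (no_types, lifting))
qed

lemma measure_UN_geometric_le:
  assumes "\<And>n. D n \<in> sets lam" "\<And>n. measure lam (D n) \<le> (1 / 2) ^ (k + Suc n)"
  shows "measure lam (\<Union>n. D n) \<le> (1 / 2) ^ k"
proof -
  have sums: "(\<lambda>n. (1 / 2) ^ (k + Suc n)) sums ((1 / 2 :: real) ^ k)"
    using sums_mult[OF power_half_series, of "(1 / 2) ^ k"] by (simp add: power_add)
  have summ: "summable (\<lambda>n. measure lam (D n))"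
    using assms(2) by (intro summable_comparison_test'[OF sums_summable[OF sums]]) simp
  have "measure lam (\<Union>n. D n) \<le> (\<Sum>n. measure lam (D n))"
    using assms(1) by (intro lam.finite_measure_subadditive_countably summ) auto
  also have "\<dots> \<le> (\<Sum>n. (1 / 2) ^ (k + Suc n))"
    using assms(2) by (intro suminf_le summ sums_summable[OF sums])
  also have "\<dots> = (1 / 2) ^ k"
    using sums by (rule sums_unique[symmetric])
  finally show ?thesis .
qed

lemma emeasure_le_iff: "emeasure lam A \<le> ennreal ((1 / 2) ^ i) \<longleftrightarrow> measure lam A \<le> (1 / 2) ^ i"
  unfolding lam.emeasure_eq_measure by (rule ennreal_le_iff) simp

subsection \<open>A universal test\<close>

definition ce_strings :: "(nat \<Rightarrow> bool list \<Rightarrow> bool) \<Rightarrow> bool" where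
  "ce_strings G \<longleftrightarrow> cep (\<lambda>z. G (pfst z) (str_of (psnd z)))"

definition stages_of :: "(nat \<Rightarrow> nat \<Rightarrow> bool list \<Rightarrow> bool) \<Rightarrow> (nat \<Rightarrow> bool list \<Rightarrow> bool) \<Rightarrow> bool" where
  "stages_of g G \<longleftrightarrow> dec (\<lambda>z. g (pfst z) (pfst (psnd z)) (str_of (psnd (psnd z)))) \<and>
     (\<forall>s t i u. s \<le> t \<longrightarrow> g s i u \<longrightarrow> g t i u) \<and> (\<forall>s i u. g s i u \<longrightarrow> str_code u < s) \<and>
     (\<forall>i u. G i u \<longleftrightarrow> (\<exists>s. g s i u))"

lemma stages_of_exists:
  assumes "ce_strings G"
  shows "\<exists>g. stages_of g G"
proof -
  obtain Q where Q: "dec (\<lambda>z. Q (pfst z) (psnd z))" "\<And>s t x. s \<le> t \<Longrightarrow> Q s x \<Longrightarrow> Q t x"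
    "\<And>s x. Q s x \<Longrightarrow> x < s" "\<And>x. G (pfst x) (str_of (psnd x)) \<longleftrightarrow> (\<exists>s. Q s x)"
    using cep_stages[OF assms[unfolded ce_strings_def]] by blast
  have "dec (\<lambda>z. Q (pfst z) (pair (pfst (psnd z)) (str_code (str_of (psnd (psnd z))))))"
    unfolding str_code_str_of by (intro dec_subst2[OF Q(1)] pr_intros)
  moreover have "str_code u < s" if "Q s (pair i (str_code u))" for s i u
    using Q(3)[OF that] le_prod_encode_2 by (rule order.strict_trans1[rotated])
  moreover have "G i u \<longleftrightarrow> (\<exists>s. Q s (pair i (str_code u)))" for i u
    using Q(4)[of "pair i (str_code u)"] by simp
  ultimately show ?thesis
    using Q(2) unfolding stages_of_def
    by (intro exI[of _ "\<lambda>s i u. Q s (pair i (str_code u))"]) blast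
qed

lemma
  assumes "stages_of g G"
  shows stages_of_mono: "s \<le> t \<Longrightarrow> g s i u \<Longrightarrow> g t i u"
    and stages_of_less: "g s i u \<Longrightarrow> str_code u < s"
    and stages_of_iff: "G i u \<longleftrightarrow> (\<exists>s. g s i u)"
  using assms unfolding stages_of_def by blast+

lemma stages_of_dec:
  assumes "stages_of g G" "pr s" "pr i" "pr c"
  shows "dec (\<lambda>x. g (s x) (i x) (str_of (c x)))"
proof -
  have "dec (\<lambda>z. g (pfst z) (pfst (psnd z)) (str_of (psnd (psnd z))))"
    using assms(1) by (simp add: stages_of_def)
  from dec_subst3[of "\<lambda>s i c. g s i (str_of c)", OF this assms(2-)] show ?thesis .
qed

lemma stages_of_length: "stages_of g G \<Longrightarrow> g s i u \<Longrightarrow> length u < s"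
  using stages_of_less length_le_str_code by (rule order.strict_trans1[rotated])

text \<open>From sequence number \<open>e\<close> take component \<open>i + Suc e\<close>,
  restricted to stages of measure at most 2^-(i+e+1); these bounds sum to 2^-i. A genuine test
  passes the restriction at every stage, so \<open>G i\<close> contains one of its components
  completely.\<close>

lemma universal_test_exists:
  "\<exists>G. ce_strings G \<and> (\<forall>i. measure lam (gen_open (G i)) \<le> (1 / 2) ^ i) \<and>
     (\<forall>V i. mltest V \<longrightarrow> (\<Inter>k. V k) \<subseteq> gen_open (G i))"
proof -
  \<comment> \<open>The index packs the number of a sequence with that of a component, so one
    approximation by stages serves all sequences.\<close>
  define K where "K j t \<longleftrightarrow> univ_ce (pfst j) (pair (psnd j) (str_code t))" for j t
  have "ce_strings K"
    unfolding ce_strings_def K_def str_code_str_of by (intro cep_subst2[OF cep_univ_ce] pr_intros)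
  then obtain q where q: "stages_of q K"
    using stages_of_exists by blast
  define Op where "Op s e k = gen_open (q s (pair e k))" for s e k
  define count where "count s e k = (\<Sum>r<2 ^ Suc s. of_bool (length (str_of r) = s \<and>
      (\<exists>t<s. q s (pair e k) (str_of t) \<and> prefix (str_of t) (str_of r))) :: nat)" for s e k
  have "(\<exists>t. q s (pair e k) t \<and> prefix t u) \<longleftrightarrow> (\<exists>t<s. q s (pair e k) (str_of t) \<and> prefix (str_of t) u)"
    for s e k u
    using stages_of_less[OF q] by (metis str_of_str_code)
  then have Op: "measure lam (Op s e k) = count s e k * (1 / 2) ^ s" for s e k
    unfolding Op_def count_def
    using measure_gen_open_bounded_length[of "q s (pair e k)" s] stages_of_length[OF q]
    by (simp add: less_imp_le)
  \<comment> \<open>Clearing the powers of 1/2 leaves an inequality of natural numbers, which makes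
    the measure test decidable.\<close>
  have small: "count s e k * 2 ^ k \<le> 2 ^ s \<longleftrightarrow> measure lam (Op s e k) \<le> (1 / 2) ^ k" for s e k
  proof -
    have "count s e k * 2 ^ k \<le> 2 ^ s \<longleftrightarrow> real (count s e k) * 2 ^ k \<le> 2 ^ s"
      unfolding of_nat_le_iff[where 'a = real, symmetric] by simp
    then show ?thesis
      unfolding Op power_one_over by (simp add: divide_simps)
  qed
  define G where "G i t \<longleftrightarrow> (\<exists>e s. q s (pair e (i + Suc e)) t \<and>
      count s e (i + Suc e) * 2 ^ (i + Suc e) \<le> 2 ^ s)" for i t
  have "ce_strings G"
    unfolding ce_strings_def G_def count_def
    by (intro cep_ex cep_dec dec_conj stages_of_dec[OF q] dec_prefix pr_length pr_intros)
  moreover have "measure lam (gen_open (G i)) \<le> (1 / 2) ^ i" for i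
  proof -
    define D where "D e = (\<Union>s\<in>{s. measure lam (Op s e (i + Suc e)) \<le> (1 / 2) ^ (i + Suc e)}. Op s e (i + Suc e))" for e
    have "incseq (\<lambda>s. Op s e k)" for e k
      unfolding Op_def by (intro monoI subsetI) (auto simp: mem_gen_open intro: stages_of_mono[OF q])
    then have "measure lam (D e) \<le> (1 / 2) ^ (i + Suc e)" for e
      unfolding D_def by (intro measure_UN_incseq_le) (auto simp: Op_def)
    moreover have "D e \<in> sets lam" for e
      unfolding D_def by (intro sets.countable_UN') (auto simp: Op_def)
    moreover have "gen_open (G i) = (\<Union>e. D e)"
      unfolding G_def small D_def Op_def gen_open_def by blast
    ultimately show ?thesis
      using measure_UN_geometric_le[of D i] by simp
  qed
  moreover have "(\<Inter>k. V k) \<subseteq> gen_open (G i)" if "mltest V" for V i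
  proof -
    from that obtain e where e: "V k = gen_open (\<lambda>t. univ_ce e (pair k (str_code t)))" for k
      unfolding mltest_def using unif_eff_open_index by blast
    let ?k = "i + Suc e"
    have V: "V ?k = gen_open (K (pair e ?k))"
      unfolding e by (simp add: K_def[abs_def])
    have "Op s e ?k \<subseteq> V ?k" for s
      unfolding V Op_def gen_open_def using stages_of_iff[OF q] by blast
    then have "measure lam (Op s e ?k) \<le> measure lam (V ?k)" for s
      unfolding V by (intro measure_mono) auto
    also have "measure lam (V ?k) \<le> (1 / 2) ^ ?k"
      using that unfolding mltest_def emeasure_le_iff by blast
    finally have "G i t" if "K (pair e ?k) t" for t
      using that unfolding G_def small stages_of_iff[OF q] by blast
    then have "V ?k \<subseteq> gen_open (G i)"
      unfolding V gen_open_def by blast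
    then show ?thesis by blast
  qed
  ultimately show ?thesis by blast
qed

subsection \<open>The diagonal construction\<close>

definition cell :: "nat \<Rightarrow> bool list" where
  "cell i = replicate i False @ [True]"

lemma length_cell [simp]: "length (cell i) = Suc i"
  by (simp add: cell_def)

text \<open>Prefixing a 0 doubles the successor of the code, and the string 1 has code 2. The closed
  form makes the cell primitive recursive in \<open>i\<close>.\<close>

lemma cell_eq_str_of: "cell i = str_of (3 * 2 ^ i - 1)"
proof -
  have "Suc (str_code (cell i)) = 3 * 2 ^ i"
    by (induction i) (auto simp: cell_def)
  then have "str_code (cell i) = 3 * 2 ^ i - 1" by simp
  then show ?thesis by (metis str_of_str_code)
qed

lemma mem_cyl_cell: "X \<in> cyl (cell i) \<longleftrightarrow> X i \<and> (\<forall>j<i. \<not> X j)"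
  by (auto simp: cyl_def cell_def nth_append less_Suc_eq)

lemma cells_disjoint: "X \<in> cyl (cell i) \<Longrightarrow> X \<in> cyl (cell j) \<Longrightarrow> i = j"
  unfolding mem_cyl_cell by (metis linorder_neqE_nat)

text \<open>G generates a universal test; K i generates the candidate for an open set that coincides
  with the complement of A off the i-th layer.\<close>

locale diagonal =
  fixes G K :: "nat \<Rightarrow> bool list \<Rightarrow> bool" and g k :: "nat \<Rightarrow> nat \<Rightarrow> bool list \<Rightarrow> bool"
  assumes g: "stages_of g G" and k: "stages_of k K"
    and small: "measure lam (gen_open (G i)) \<le> (1 / 2) ^ i"
begin

text \<open>One number is both the stage and the level of the finite cover. The condition
  \<open>i < s\<close> excludes levels below the length of the cell, where the rest would hold
  vacuously.\<close>

definition covered :: "nat \<Rightarrow> nat \<Rightarrow> bool" where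
  "covered i s \<longleftrightarrow> i < s \<and> (\<forall>r. length r = s \<longrightarrow> prefix (cell i) r \<longrightarrow>
     (\<exists>t. (g s (i + 2) t \<or> k s i t) \<and> prefix t r))"

definition first_covered :: "nat \<Rightarrow> nat \<Rightarrow> bool" where
  "first_covered i s \<longleftrightarrow> covered i s \<and> (\<forall>s'<s. \<not> covered i s')"

text \<open>The length encodes the pair (i, s), so at most one string of each length is chosen; this is what makes
  A effectively measurable.\<close>

definition candidate :: "nat \<Rightarrow> nat \<Rightarrow> bool list \<Rightarrow> bool" where
  "candidate i s u \<longleftrightarrow> length u = pair i s \<and> prefix (cell i) u \<and> \<not> (\<exists>t. g s (i + 2) t \<and> prefix t u)"

text \<open>The string carries its own cell and stage in its length; the least code makes the choice
  both unique and decidable.\<close>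

definition chosen :: "bool list \<Rightarrow> bool" where
  "chosen u \<longleftrightarrow> first_covered (pfst (length u)) (psnd (length u)) \<and>
     candidate (pfst (length u)) (psnd (length u)) u \<and>
     (\<forall>c<str_code u. \<not> candidate (pfst (length u)) (psnd (length u)) (str_of c))"

definition A :: "(nat \<Rightarrow> bool) set" where
  "A = gen_open chosen"

definition layer :: "nat \<Rightarrow> bool list \<Rightarrow> bool" where
  "layer i u \<longleftrightarrow> (\<exists>t. g t (i + 2) u \<and> (\<forall>s<t. \<not> covered i s)) \<or>
     (\<exists>s. first_covered i s \<and> G (Suc (pair i s)) u)"

definition W :: "nat \<Rightarrow> (nat \<Rightarrow> bool) set" where
  "W i = gen_open (layer i)"

section \<open>Decidability of the construction\<close>

lemma dec_covered:
  assumes "pr i" "pr s"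
  shows "dec (\<lambda>x. covered (i x) (s x))"
proof -
  have *: "covered i s \<longleftrightarrow> i < s \<and> (\<forall>r<2 ^ Suc s. length (str_of r) = s \<longrightarrow>
      prefix (str_of (3 * 2 ^ i - 1)) (str_of r) \<longrightarrow>
      (\<exists>t<s. (g s (i + 2) (str_of t) \<or> k s i (str_of t)) \<and> prefix (str_of t) (str_of r)))"
    for i s
  proof -
    have ex: "(\<exists>t. (g s (i + 2) t \<or> k s i t) \<and> prefix t r) \<longleftrightarrow>
        (\<exists>t<s. (g s (i + 2) (str_of t) \<or> k s i (str_of t)) \<and> prefix (str_of t) r)" for r
      using stages_of_less[OF g] stages_of_less[OF k] by (metis str_of_str_code)
    show ?thesis
      unfolding covered_def ex cell_eq_str_of by (rule arg_cong2[OF refl all_length_iff])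
  qed
  show ?thesis
    unfolding *
    by (intro dec_conj dec_ball dec_imp dec_bex dec_disj stages_of_dec[OF g] stages_of_dec[OF k]
        dec_prefix pr_length pr_compose[OF assms(1)] pr_compose[OF assms(2)] assms pr_intros)
qed

lemma dec_first_covered:
  assumes "pr i" "pr s"
  shows "dec (\<lambda>x. first_covered (i x) (s x))"
  unfolding first_covered_def
  by (intro dec_conj dec_ball dec_not dec_covered pr_compose[OF assms(1)] assms pr_intros)

lemma dec_candidate:
  assumes "pr i" "pr s" "pr c"
  shows "dec (\<lambda>x. candidate (i x) (s x) (str_of (c x)))"
proof -
  have *: "candidate i s u \<longleftrightarrow> length u = pair i s \<and> prefix (str_of (3 * 2 ^ i - 1)) u \<and>
      \<not> (\<exists>t<s. g s (i + 2) (str_of t) \<and> prefix (str_of t) u)" for i s u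
    unfolding candidate_def cell_eq_str_of
    using stages_of_less[OF g] by (metis str_of_str_code)
  show ?thesis
    unfolding *
    by (intro dec_conj dec_not dec_bex stages_of_dec[OF g] dec_prefix dec_eq pr_length
        pr_compose[OF assms(1)] pr_compose[OF assms(2)] pr_compose[OF assms(3)] assms pr_intros)
qed

lemma dec_chosen: "pr c \<Longrightarrow> dec (\<lambda>x. chosen (str_of (c x)))"
proof -
  assume c: "pr c"
  show ?thesis
    unfolding chosen_def str_code_str_of
    by (intro dec_conj dec_ball dec_not dec_first_covered dec_candidate pr_length pr_pfst pr_psnd
        pr_compose[OF c] c pr_intros)
qed

lemma chosen_unique:
  assumes "chosen u" "chosen v" "length u = length v"
  shows "u = v"
proof -
  have "\<not> str_code u < str_code v" "\<not> str_code v < str_code u"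
    using assms unfolding chosen_def by (metis str_of_str_code)+
  then show ?thesis by (simp add: str_code_inject[symmetric])
qed

text \<open>\<open>A\<close> is its own outer approximation. The complement is approximated by
  strings of length \<open>n\<close> without a chosen prefix: points that avoid them have a chosen
  prefix and lie in \<open>A\<close>, and the overlap with \<open>A\<close> comes only from chosen
  strings longer than \<open>n\<close>, at most one per length.\<close>

lemma eff_measurable_A: "eff_measurable A"
proof -
  define N where "N n s \<longleftrightarrow> length s = n \<and> \<not> (\<exists>t. chosen t \<and> prefix t s)" for n s
  have N: "N n (str_of c) \<longleftrightarrow> length (str_of c) = n \<and>
      \<not> (\<exists>t<Suc c. chosen (str_of t) \<and> prefix (str_of t) (str_of c))" for n c
  proof -
    have "str_code t < Suc c" if "prefix t (str_of c)" for t
      using prefix_str_of[of "str_code t" c] that by auto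
    then show ?thesis unfolding N_def by (metis str_of_str_code)
  qed
  have "unif_eff_open (\<lambda>_. A)"
    unfolding A_def by (intro unif_eff_open_gen_open cep_dec dec_chosen pr_intros)
  moreover have "unif_eff_open (\<lambda>n. gen_open (N n))"
    by (intro unif_eff_open_gen_open, unfold N)
      (intro cep_dec dec_conj dec_not dec_bex dec_chosen dec_prefix pr_length pr_intros)
  moreover have "- gen_open (N n) \<subseteq> A" for n
  proof
    fix X assume "X \<in> - gen_open (N n)"
    then have "\<not> N n (restr X n)"
      using mem_gen_open mem_cyl_restr by blast
    then obtain t where "chosen t" "prefix t (restr X n)" by (auto simp: N_def)
    then show "X \<in> A"
      unfolding A_def mem_gen_open using cyl_mono mem_cyl_restr by blast
  qed
  moreover have "emeasure lam (A \<inter> gen_open (N n)) \<le> ennreal ((1 / 2) ^ n)" for n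
  proof -
    define D where "D m = gen_open (\<lambda>t. chosen t \<and> length t = n + Suc m)" for m
    have "measure lam (D m) \<le> (1 / 2) ^ (n + Suc m)" for m
    proof (cases "\<exists>t. chosen t \<and> length t = n + Suc m")
      case True
      then obtain t where t: "chosen t" "length t = n + Suc m" by blast
      then have "D m \<subseteq> cyl t"
        unfolding D_def gen_open_def using chosen_unique by force
      then have "measure lam (D m) \<le> measure lam (cyl t)"
        by (rule measure_mono) simp
      then show ?thesis unfolding measure_cyl t(2) .
    next
      case False
      then have "D m = {}" by (auto simp: D_def gen_open_def)
      then show ?thesis by simp
    qed
    then have "measure lam (\<Union>m. D m) \<le> (1 / 2) ^ n"
      by (intro measure_UN_geometric_le) (auto simp: D_def)
    moreover have "A \<inter> gen_open (N n) \<subseteq> (\<Union>m. D m)"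
    proof
      fix X assume "X \<in> A \<inter> gen_open (N n)"
      then obtain t s where ts: "chosen t" "X \<in> cyl t" "N n s" "X \<in> cyl s"
        unfolding A_def Int_iff mem_gen_open by blast
      then have "\<not> length t \<le> n"
        using prefix_of_mem_cyl[of X t s] by (auto simp: N_def)
      then have "length t = n + Suc (length t - Suc n)" by simp
      then show "X \<in> (\<Union>m. D m)"
        using ts unfolding D_def UN_iff mem_gen_open by blast
    qed
    then have "measure lam (A \<inter> gen_open (N n)) \<le> measure lam (\<Union>m. D m)"
      by (intro measure_mono) (auto simp: D_def)
    ultimately show ?thesis
      unfolding emeasure_le_iff by simp
  qed
  ultimately show ?thesis
    unfolding eff_measurable_def by blast
qed

section \<open>The layers form a universal test\<close>

lemma W_not_covered:
  assumes "\<And>s. \<not> covered i s"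
  shows "W i = gen_open (G (i + 2))"
proof -
  have "layer i = G (i + 2)"
    using assms by (auto simp: fun_eq_iff layer_def first_covered_def stages_of_iff[OF g])
  then show ?thesis by (simp add: W_def)
qed

lemma W_covered:
  assumes "first_covered i s"
  shows "W i = gen_open (g s (i + 2)) \<union> gen_open (G (Suc (pair i s)))"
proof -
  have stop: "(\<forall>s'<t. \<not> covered i s') \<longleftrightarrow> t \<le> s" for t
    using assms unfolding first_covered_def by (meson leI le_less_trans not_le)
  have unique: "first_covered i s' \<longleftrightarrow> s' = s" for s'
    using assms unfolding first_covered_def by (meson linorder_neqE_nat)
  have "layer i u \<longleftrightarrow> g s (i + 2) u \<or> G (Suc (pair i s)) u" for u
    unfolding layer_def stop unique using stages_of_mono[OF g] by blast
  then show ?thesis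
    by (auto simp: W_def gen_open_def)
qed

lemma first_covered_exists: "covered i s \<Longrightarrow> \<exists>s. first_covered i s"
  unfolding first_covered_def by (rule exists_least_iff[THEN iffD1]) blast

lemma gen_open_stage_subset: "gen_open (g s i) \<subseteq> gen_open (G i)"
  unfolding gen_open_def using stages_of_iff[OF g] by blast

lemma mltest_W:
  assumes "ce_strings G"
  shows "mltest W"
proof -
  have "cep (\<lambda>z. layer (pfst z) (str_of (psnd z)))"
    unfolding layer_def
    by (intro cep_disj cep_ex cep_conj cep_dec[OF stages_of_dec[OF g]]
        cep_dec[OF dec_ball[OF _ dec_not[OF dec_covered]]] cep_dec[OF dec_first_covered]
        cep_subst2[OF assms[unfolded ce_strings_def], simplified] pr_intros)
  then have "unif_eff_open W"
    unfolding W_def by (rule unif_eff_open_gen_open)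
  moreover have "measure lam (W i) \<le> (1 / 2) ^ i" for i
  proof (cases "\<exists>s. covered i s")
    case True
    then obtain s where s: "first_covered i s"
      using first_covered_exists by blast
    have "measure lam (W i) \<le> measure lam (gen_open (g s (i + 2))) + measure lam (gen_open (G (Suc (pair i s))))"
      unfolding W_covered[OF s] by (rule measure_Un_le) auto
    also have "\<dots> \<le> measure lam (gen_open (G (i + 2))) + measure lam (gen_open (G (Suc (pair i s))))"
      by (intro add_right_mono measure_mono gen_open_stage_subset) simp
    also have "\<dots> \<le> (1 / 2) ^ (i + 2) + (1 / 2) ^ Suc (pair i s)"
      by (intro add_mono small)
    \<comment> \<open>\<open>pair i s\<close> is at least \<open>i\<close>, so the added component
      costs at most half of 2^-i, beside the quarter already spent.\<close>
    also have "(1 / 2) ^ Suc (pair i s) \<le> (1 / 2 :: real) ^ Suc i"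
      by (intro power_decreasing) (auto intro: le_prod_encode_1)
    also have "(1 / 2) ^ (i + 2) + (1 / 2) ^ Suc i \<le> (1 / 2 :: real) ^ i"
      by simp
    finally show ?thesis by simp
  next
    case False
    then have "W i = gen_open (G (i + 2))"
      by (intro W_not_covered) blast
    then have "measure lam (W i) \<le> (1 / 2) ^ (i + 2)"
      by (simp only: small)
    also have "\<dots> \<le> (1 / 2) ^ i"
      by (intro power_decreasing) auto
    finally show ?thesis .
  qed
  ultimately show ?thesis
    unfolding mltest_def emeasure_le_iff by blast
qed

text \<open>Gives universality: the intersection of any test lies in every component of
  \<open>G\<close>, hence in every layer.\<close>

lemma W_superset: "\<exists>j. gen_open (G j) \<subseteq> W i"
proof (cases "\<exists>s. covered i s")
  case True
  then obtain s where "first_covered i s"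
    using first_covered_exists by blast
  then show ?thesis using W_covered by blast
next
  case False
  then show ?thesis using W_not_covered by blast
qed

section \<open>The layers defeat every competitor\<close>

lemma covered_if_cyl_subset:
  assumes "cyl (cell i) \<subseteq> gen_open (G (i + 2)) \<union> gen_open (K i)"
  shows "\<exists>s. covered i s"
proof -
  have "gen_open (G (i + 2)) \<union> gen_open (K i) = gen_open (\<lambda>t. G (i + 2) t \<or> K i t)"
    by (auto simp: gen_open_def)
  with assms have "cyl (cell i) \<subseteq> gen_open (\<lambda>t. G (i + 2) t \<or> K i t)"
    by (simp only:)
  then obtain n where n: "length (cell i) \<le> n"
    "\<And>r. length r = n \<Longrightarrow> prefix (cell i) r \<Longrightarrow> \<exists>t. (G (i + 2) t \<or> K i t) \<and> prefix t r"
    unfolding cyl_subset_gen_open_iff by blast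
  let ?R = "{r. length r = n \<and> prefix (cell i) r}"
  have "\<forall>r\<in>?R. \<exists>s. \<exists>t. (g s (i + 2) t \<or> k s i t) \<and> prefix t r"
    using n(2) stages_of_iff[OF g] stages_of_iff[OF k] by blast
  then obtain S where S: "\<And>r. r \<in> ?R \<Longrightarrow> \<exists>t. (g (S r) (i + 2) t \<or> k (S r) i t) \<and> prefix t r"
    by metis
  have "finite ?R"
    by (rule finite_subset[OF _ finite_lists_length_eq[of UNIV n]]) auto
  \<comment> \<open>The finitely many strings at level \<open>n\<close> are covered at stages of
    their own; \<open>s\<close> exceeds none of its roles by being at least \<open>n\<close> and at
    least every \<open>S r\<close>.\<close>
  define s where "s = n + (\<Sum>r\<in>?R. S r)"
  have s: "S r \<le> s" if "r \<in> ?R" for r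
    using member_le_sum[OF that _ \<open>finite ?R\<close>, of S] by (simp add: s_def)
  have "covered i s"
    unfolding covered_def
  proof (intro conjI allI impI)
    show "i < s" using n(1) by (simp add: s_def)
    fix r assume r: "length r = s" "prefix (cell i) r"
    have "length (take n r) = n"
      using r by (simp add: s_def)
    moreover have "prefix (cell i) (take n r)"
      using r n(1) by (intro prefix_length_prefix[OF _ take_is_prefix]) (auto simp: s_def)
    ultimately have R: "take n r \<in> ?R" by blast
    then obtain t where t: "g (S (take n r)) (i + 2) t \<or> k (S (take n r)) i t" "prefix t (take n r)"
      using S by blast
    have "g s (i + 2) t \<or> k s i t"
      using t(1) stages_of_mono[OF g s[OF R]] stages_of_mono[OF k s[OF R]] by blast
    moreover have "prefix t r"
      using t(2) take_is_prefix by (rule prefix_order.trans)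
    ultimately show "\<exists>t. (g s (i + 2) t \<or> k s i t) \<and> prefix t r" by blast
  qed
  then show ?thesis ..
qed

text \<open>The component enumerated so far has at most half the measure of the cell. A point of the
  cell outside it supplies a candidate by restriction.\<close>

lemma chosen_exists:
  assumes "first_covered i s"
  shows "\<exists>u. chosen u \<and> length u = pair i s"
proof -
  have "measure lam (gen_open (g s (i + 2))) \<le> measure lam (gen_open (G (i + 2)))"
    by (intro measure_mono gen_open_stage_subset) simp
  also have "\<dots> \<le> (1 / 2) ^ (i + 2)"
    by (rule small)
  also have "\<dots> < measure lam (cyl (cell i))"
    by (simp add: measure_cyl)
  finally have "\<not> cyl (cell i) \<subseteq> gen_open (g s (i + 2))"
    using measure_mono[of "cyl (cell i)" "gen_open (g s (i + 2))"] by auto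
  then obtain X where X: "X \<in> cyl (cell i)" "X \<notin> gen_open (g s (i + 2))" by blast
  have "i < s"
    using assms by (simp add: first_covered_def covered_def)
  then have "length (cell i) \<le> pair i s"
    using le_prod_encode_2[of s i] by simp
  then have "candidate i s (restr X (pair i s))"
    using X unfolding candidate_def mem_gen_open
    by (metis length_restr prefix_length_le prefix_restr)
  then have ex: "\<exists>c. candidate i s (str_of c)"
    by (metis str_of_str_code)
  define u where "u = str_of (LEAST c. candidate i s (str_of c))"
  have "candidate i s u"
    unfolding u_def using ex by (rule LeastI_ex)
  moreover have "\<not> candidate i s (str_of c)" if "c < str_code u" for c
    using that not_less_Least unfolding u_def str_code_str_of by blast
  moreover have "length u = pair i s"
    using \<open>candidate i s u\<close> by (simp add: candidate_def)
  ultimately show ?thesis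
    using assms by (intro exI[of _ u]) (simp add: chosen_def)
qed

lemma complement_A_ne: "- A \<inter> - W i \<noteq> gen_open (K i) \<inter> - W i"
proof (cases "\<exists>s. covered i s")
  case False
  with covered_if_cyl_subset obtain X where X: "X \<in> cyl (cell i)" "X \<notin> gen_open (G (i + 2))"
      "X \<notin> gen_open (K i)"
    by blast
  have "X \<notin> A"
  proof
    assume "X \<in> A"
    then obtain u where u: "chosen u" "X \<in> cyl u" unfolding A_def mem_gen_open by blast
    then have "prefix (cell (pfst (length u))) u" "covered (pfst (length u)) (psnd (length u))"
      by (auto simp: chosen_def candidate_def first_covered_def)
    \<comment> \<open>\<open>u\<close> lies in the cell whose number its length encodes, and
      \<open>X\<close> lies in both cells.\<close>
    moreover from this have "pfst (length u) = i"
      using cyl_mono cells_disjoint X(1) u(2) by blast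
    ultimately show False using False by blast
  qed
  moreover have "X \<notin> W i"
    using False X(2) W_not_covered by blast
  ultimately show ?thesis using X(3) by blast
next
  case True
  then obtain s where s: "first_covered i s"
    using first_covered_exists by blast
  then obtain u where u: "chosen u" "length u = pair i s"
    using chosen_exists by blast
  then have cand: "prefix (cell i) u" "\<And>t. g s (i + 2) t \<Longrightarrow> \<not> prefix t u"
    by (auto simp: chosen_def candidate_def)
  \<comment> \<open>The index \<open>Suc (pair i s)\<close> makes this component at most half as
    large as the cylinder of \<open>u\<close>.\<close>
  have "measure lam (gen_open (G (Suc (pair i s)))) \<le> (1 / 2) ^ Suc (pair i s)"
    by (rule small)
  also have "\<dots> < measure lam (cyl u)"
    by (simp add: measure_cyl u(2))
  finally have "\<not> cyl u \<subseteq> gen_open (G (Suc (pair i s)))"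
    using measure_mono[of "cyl u" "gen_open (G (Suc (pair i s)))"] by auto
  then obtain X where X: "X \<in> cyl u" "X \<notin> gen_open (G (Suc (pair i s)))" by blast
  \<comment> \<open>Strings of stage \<open>s\<close> are shorter than \<open>s\<close>, and
    \<open>u\<close> has length \<open>pair i s\<close>, which is at least \<open>s\<close>. So a
    cylinder of that stage meeting the cylinder of \<open>u\<close> would belong to a prefix of
    \<open>u\<close>.\<close>
  have notg: "X \<notin> cyl t" if "g s (i + 2) t" for t
  proof
    assume "X \<in> cyl t"
    moreover have "length t \<le> length u"
      using stages_of_length[OF g that] le_prod_encode_2[of s i] u(2) by simp
    ultimately have "prefix t u"
      using X(1) by (intro prefix_of_mem_cyl)
    with cand(2) that show False by blast
  qed
  then have "X \<notin> W i"
    using X(2) unfolding W_covered[OF s] Un_iff mem_gen_open by blast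
  moreover have "X \<in> A"
    unfolding A_def mem_gen_open using u X by blast
  moreover have "X \<in> gen_open (K i)"
  proof -
    have cov: "i < s" "\<And>r. length r = s \<Longrightarrow> prefix (cell i) r \<Longrightarrow>
        \<exists>t. (g s (i + 2) t \<or> k s i t) \<and> prefix t r"
      using s by (auto simp: first_covered_def covered_def)
    have "X \<in> cyl (cell i)"
      using cand(1) X(1) cyl_mono by blast
    then have "prefix (cell i) (restr X s)"
      using cov(1) by (simp add: prefix_restr)
    with cov(2)[of "restr X s"] obtain t where t: "g s (i + 2) t \<or> k s i t" "prefix t (restr X s)"
      by auto
    then have "X \<in> cyl t"
      using cyl_mono mem_cyl_restr by blast
    with t notg have "k s i t" by blast
    then have "K i t" using stages_of_iff[OF k] by blast
    with \<open>X \<in> cyl t\<close> show ?thesis unfolding mem_gen_open by blast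
  qed
  ultimately show ?thesis by blast
qed

end

theorem theorem4p1:
  shows "\<exists>A W. eff_measurable A \<and> universal_mltest W \<and> \<not> layerwise_dec W A"
proof -
  obtain G where G: "ce_strings G" "\<And>i. measure lam (gen_open (G i)) \<le> (1 / 2) ^ i"
    "\<And>V i. mltest V \<Longrightarrow> (\<Inter>k. V k) \<subseteq> gen_open (G i)"
    using universal_test_exists by blast
  \<comment> \<open>The diagonal: the competitor at layer \<open>i\<close> is component
    \<open>i\<close> of sequence number \<open>i\<close>.\<close>
  define K where "K i t \<longleftrightarrow> univ_ce i (pair i (str_code t))" for i t
  have "ce_strings K"
    unfolding ce_strings_def K_def str_code_str_of by (intro cep_subst2[OF cep_univ_ce] pr_intros)
  then obtain g k where gk: "stages_of g G" "stages_of k K"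
    using stages_of_exists G(1) by blast
  interpret diagonal G K g k
    by unfold_locales (rule gk G(2))+
  have "universal_mltest W"
    unfolding universal_mltest_def
    using mltest_W[OF G(1)] W_superset G(3) by blast
  moreover have "\<not> layerwise_semidec W (- A)"
  proof
    assume "layerwise_semidec W (- A)"
    then obtain U where U: "unif_eff_open U" "\<And>i. - A \<inter> - W i = U i \<inter> - W i"
      unfolding layerwise_semidec_def by blast
    then obtain i where "U j = gen_open (\<lambda>s. univ_ce i (pair j (str_code s)))" for j
      using unif_eff_open_index by blast
    then have "U i = gen_open (K i)" by (simp add: K_def[abs_def])
    with U(2)[of i] complement_A_ne[of i] show False by simp
  qed
  ultimately show ?thesis
    unfolding layerwise_dec_def using eff_measurable_A by blast
qed

end
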